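(* Let $A$ be any non-universal ceer. Then there are infinitely many pairwise $\leq$-incomparable self-full ceers $(E_l)_{l\in\omega}$ such that for every $n\geq 1$ and every $l$, $A\oplus\mathrm{Id}_n\leq E_l$, and for every ceer $X$, if $X<E_l$ then $X\leq A\oplus\mathrm{Id}_k$ for some $k\geq1$. Moreover, for each $l$, any two distinct $E_l$-equivalence classes are computably inseparable, and thus each $E_l$-equivalence class is non-computable.
   Context: A ceer is a computably enumerable equivalence relation on $\omega$. For equivalence relations $E,R$ on $\omega$, $E\leq R$ means there is a computable $f$ with $x\mathrel{E}y\iff f(x)\mathrel{R}f(y)$ for all $x,y$; $X<E$ means $X\leq E$ and $E\not\leq X$. A ceer is universal if every ceer is $\leq$ it. For $n\geq1$, $\mathrm{Id}_n$ is congruence modulo $n$. The uniform join $E\oplus R$ is defined by $2u\mathrel{(E\oplus R)}2v\iff u\mathrel{E}v$, $2u+1\mathrel{(E\oplus R)}2v+1\iff u\mathrel{R}v$, and no even number equivalent to an odd one. A ceer $E$ is self-full if for every computable $g$ that is a reduction of $E$ to $E$ and every $j$ there is $k$ with $g(k)\mathrel{E}j$. Two disjoint sets are computably inseparable if no computable set contains one and is disjoint from the other. *)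

theory Defs
  imports Main "HOL-Number_Theory.Cong"
begin

text \<open>Codes for Kleene's partial recursive functions. A code has no fixed arity: it denotes
  one partial function on argument lists of each length, undefined on lists that do not fit.\<close>

datatype recf =
    Zero
  | Succ
  | Proj nat
  | Comp recf "recf list"
  | Prec recf recf
  | Mu recf

text \<open>\<open>evals r xs y\<close>: the computation of \<open>r\<close> on \<open>xs\<close> converges with value \<open>y\<close>. The clause for
  \<open>Mu\<close> demands convergence at every argument below the zero that is found.\<close>

inductive evals :: "recf \<Rightarrow> nat list \<Rightarrow> nat \<Rightarrow> bool" where
  evals_Zero: "evals Zero xs 0"
| evals_Succ: "evals Succ [x] (Suc x)"
| evals_Proj: "i < length xs \<Longrightarrow> evals (Proj i) xs (xs ! i)"
| evals_Comp: "list_all2 (\<lambda>g y. evals g xs y) gs ys \<Longrightarrow> evals f ys z \<Longrightarrow> evals (Comp f gs) xs z"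
| evals_Prec_0: "evals f xs y \<Longrightarrow> evals (Prec f g) (0 # xs) y"
| evals_Prec_Suc: "evals (Prec f g) (n # xs) y \<Longrightarrow> evals g (n # y # xs) z
    \<Longrightarrow> evals (Prec f g) (Suc n # xs) z"
| evals_Mu: "evals f (n # xs) 0 \<Longrightarrow> (\<forall>i<n. \<exists>y. evals f (i # xs) (Suc y)) \<Longrightarrow> evals (Mu f) xs n"

definition computable :: "(nat \<Rightarrow> nat) \<Rightarrow> bool" where
  "computable f \<longleftrightarrow> (\<exists>r. \<forall>x. evals r [x] (f x))"

definition computable_set :: "nat set \<Rightarrow> bool" where
  "computable_set C \<longleftrightarrow> computable (\<lambda>x. if x \<in> C then 1 else 0)"

text \<open>Computably enumerable: the domain of a binary partial recursive function.\<close>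

definition ce_rel :: "nat rel \<Rightarrow> bool" where
  "ce_rel E \<longleftrightarrow> (\<exists>r. \<forall>x y. (x, y) \<in> E \<longleftrightarrow> (\<exists>z. evals r [x, y] z))"

definition ceer :: "nat rel \<Rightarrow> bool" where
  "ceer E \<longleftrightarrow> equiv UNIV E \<and> ce_rel E"

definition reduces_via :: "(nat \<Rightarrow> nat) \<Rightarrow> nat rel \<Rightarrow> nat rel \<Rightarrow> bool" where
  "reduces_via f E R \<longleftrightarrow> computable f \<and> (\<forall>x y. (x, y) \<in> E \<longleftrightarrow> (f x, f y) \<in> R)"

definition reducible :: "nat rel \<Rightarrow> nat rel \<Rightarrow> bool" (infix "\<le>\<^sub>c" 50) where
  "E \<le>\<^sub>c R \<longleftrightarrow> (\<exists>f. reduces_via f E R)"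

definition strictly_reducible :: "nat rel \<Rightarrow> nat rel \<Rightarrow> bool" (infix "<\<^sub>c" 50) where
  "X <\<^sub>c E \<longleftrightarrow> X \<le>\<^sub>c E \<and> \<not> E \<le>\<^sub>c X"

definition incomparable :: "nat rel \<Rightarrow> nat rel \<Rightarrow> bool" where
  "incomparable E R \<longleftrightarrow> \<not> E \<le>\<^sub>c R \<and> \<not> R \<le>\<^sub>c E"

definition universal_ceer :: "nat rel \<Rightarrow> bool" where
  "universal_ceer E \<longleftrightarrow> ceer E \<and> (\<forall>R. ceer R \<longrightarrow> R \<le>\<^sub>c E)"

definition Id_mod :: "nat \<Rightarrow> nat rel" where
  "Id_mod n = {(x, y). [x = y] (mod n)}"

definition uniform_join :: "nat rel \<Rightarrow> nat rel \<Rightarrow> nat rel" (infixl "\<oplus>\<^sub>c" 65) where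
  "E \<oplus>\<^sub>c R = {(2 * u, 2 * v) | u v. (u, v) \<in> E} \<union> {(2 * u + 1, 2 * v + 1) | u v. (u, v) \<in> R}"

definition self_full :: "nat rel \<Rightarrow> bool" where
  "self_full E \<longleftrightarrow> ceer E \<and> (\<forall>g. reduces_via g E E \<longrightarrow> (\<forall>j. \<exists>k. (g k, j) \<in> E))"

definition computably_inseparable :: "nat set \<Rightarrow> nat set \<Rightarrow> bool" where
  "computably_inseparable S T \<longleftrightarrow> S \<inter> T = {} \<and>
     \<not> (\<exists>C. computable_set C \<and> (S \<subseteq> C \<and> T \<inter> C = {} \<or> T \<subseteq> C \<and> S \<inter> C = {}))"

end

theory Submission
  imports Defs "HOL-Library.Nat_Bijection"
begin

text \<open>Given ceers \<open>A\<close>, \<open>R\<close>, \<open>V\<close> with \<open>V\<close> not reducible to \<open>R\<close>, a finite-injury construction builds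
  a ceer \<open>E\<close> that copies \<open>A\<close> on the even numbers. For each \<open>n\<close>, as long as the \<open>n\<close>-th partial
  recursive function looks like a reduction of \<open>E\<close> to \<open>R\<close>, longer and longer initial segments of
  \<open>V\<close> are coded into \<open>E\<close> at fresh odd locations; since \<open>V\<close> does not reduce to \<open>R\<close> this stops,
  so \<open>E\<close> does not reduce to \<open>R\<close>, and the locations that remain give infinitely many classes without even
  numbers. For each c.e. set \<open>W\<close> and target \<open>t\<close>, an element of \<open>W\<close> that is neither equivalent to an
  even number nor to a location of higher priority is merged with \<open>t\<close>. Hence every c.e. set either
  meets all classes of \<open>E\<close> or is covered by the even numbers and finitely many further classes.

  This dichotomy for the range of a reduction \<open>X \<le>\<^sub>c E\<close> gives \<open>E \<le>\<^sub>c X\<close> or \<open>X \<le>\<^sub>c A \<oplus>\<^sub>c Id_mod k\<close>,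
  and it makes any two classes computably inseparable, so that \<open>E\<close> is join-irreducible. In
  particular the join of two non-universal ceers is non-universal, so one can start with \<open>R = A\<close> and
  join each new ceer \<open>E l\<close> to \<open>R\<close>; then \<open>E m\<close> does not reduce to \<open>E l\<close> for \<open>l < m\<close>, and the
  dichotomy excludes the converse reduction.\<close>

section \<open>Computable functions on coded types\<close>

definition recl :: "nat \<Rightarrow> (nat list \<Rightarrow> nat) \<Rightarrow> bool" where
  "recl k f \<longleftrightarrow> (\<exists>r. \<forall>xs. length xs = k \<longrightarrow> evals r xs (f xs))"

named_theorems recl_intros

lemma recl_zero [recl_intros]: "recl k (\<lambda>xs. 0)"
  unfolding recl_def using evals_Zero by blast

lemma recl_proj [recl_intros]: "i < k \<Longrightarrow> recl k (\<lambda>xs. xs ! i)"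
  unfolding recl_def using evals_Proj by blast

lemma recl_comp1:
  assumes "recl 1 (\<lambda>xs. F (xs ! 0))" and "recl k g"
  shows "recl k (\<lambda>xs. F (g xs))"
proof -
  obtain r where r: "\<And>xs. length xs = 1 \<Longrightarrow> evals r xs (F (xs ! 0))"
    using assms(1) unfolding recl_def by blast
  obtain q where q: "\<And>xs. length xs = k \<Longrightarrow> evals q xs (g xs)"
    using assms(2) unfolding recl_def by blast
  have "evals (Comp r [q]) xs (F (g xs))" if "length xs = k" for xs
    using q[OF that] r[of "[g xs]"] by (intro evals_Comp[where ys = "[g xs]"]) auto
  thus ?thesis unfolding recl_def by blast
qed

lemma recl_comp2:
  assumes "recl 2 (\<lambda>xs. F (xs ! 0) (xs ! 1))" and "recl k g" "recl k h"
  shows "recl k (\<lambda>xs. F (g xs) (h xs))"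
proof -
  obtain r where r: "\<And>xs. length xs = 2 \<Longrightarrow> evals r xs (F (xs ! 0) (xs ! 1))"
    using assms(1) unfolding recl_def by blast
  obtain q where q: "\<And>xs. length xs = k \<Longrightarrow> evals q xs (g xs)"
    using assms(2) unfolding recl_def by blast
  obtain p where p: "\<And>xs. length xs = k \<Longrightarrow> evals p xs (h xs)"
    using assms(3) unfolding recl_def by blast
  have "evals (Comp r [q, p]) xs (F (g xs) (h xs))" if "length xs = k" for xs
    using q[OF that] p[OF that] r[of "[g xs, h xs]"]
    by (intro evals_Comp[where ys = "[g xs, h xs]"]) auto
  thus ?thesis unfolding recl_def by blast
qed

lemma recl_Suc [recl_intros]: "recl k g \<Longrightarrow> recl k (\<lambda>xs. Suc (g xs))"
proof (rule recl_comp1[where F = Suc])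
  have "evals Succ xs (Suc (xs ! 0))" if "length xs = 1" for xs
    using that evals_Succ by (cases xs) auto
  thus "recl 1 (\<lambda>xs. Suc (xs ! 0))" unfolding recl_def by blast
qed

lemma recl_prec0:
  assumes "recl 2 (\<lambda>xs. G (xs ! 0) (xs ! 1))"
  shows "recl 1 (\<lambda>xs. rec_nat 0 G (xs ! 0))"
proof -
  obtain r where r: "\<And>xs. length xs = 2 \<Longrightarrow> evals r xs (G (xs ! 0) (xs ! 1))"
    using assms(1) unfolding recl_def by blast
  have "evals (Prec Zero r) [n] (rec_nat 0 G n)" for n
  proof (induction n)
    case 0
    show ?case by (auto intro: evals_Prec_0 evals_Zero)
  next
    case (Suc n)
    show ?case using evals_Prec_Suc[OF Suc] r[of "[n, rec_nat 0 G n]"] by simp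
  qed
  hence "evals (Prec Zero r) xs (rec_nat 0 G (xs ! 0))" if "length xs = 1" for xs
    using that by (cases xs) auto
  thus ?thesis unfolding recl_def by blast
qed

text \<open>\<open>Prec\<close> hands its step function the counter, the previous value and then the
  parameters, hence the positions 0, 1, 2. One parameter is enough, since several can be packed by
  pairing.\<close>

lemma recl_prec1:
  assumes "recl 1 (\<lambda>xs. b (xs ! 0))" "recl 3 (\<lambda>xs. G (xs ! 2) (xs ! 0) (xs ! 1))"
  shows "recl 2 (\<lambda>xs. rec_nat (b (xs ! 1)) (G (xs ! 1)) (xs ! 0))"
proof -
  obtain q where q: "\<And>xs. length xs = 1 \<Longrightarrow> evals q xs (b (xs ! 0))"
    using assms(1) unfolding recl_def by blast
  obtain r where r: "\<And>xs. length xs = 3 \<Longrightarrow> evals r xs (G (xs ! 2) (xs ! 0) (xs ! 1))"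
    using assms(2) unfolding recl_def by blast
  have "evals (Prec q r) [n, p] (rec_nat (b p) (G p) n)" for n p
  proof (induction n)
    case 0
    show ?case using q[of "[p]"] by (auto intro: evals_Prec_0)
  next
    case (Suc n)
    show ?case using evals_Prec_Suc[OF Suc] r[of "[n, rec_nat (b p) (G p) n, p]"] by simp
  qed
  hence "evals (Prec q r) xs (rec_nat (b (xs ! 1)) (G (xs ! 1)) (xs ! 0))" if "length xs = 2" for xs
    using that by (cases xs; cases "tl xs") auto
  thus ?thesis unfolding recl_def by blast
qed

lemma recl_add [recl_intros]:
  assumes "recl k g" "recl k h" shows "recl k (\<lambda>xs. g xs + h xs)"
proof (rule recl_comp2[OF _ assms, where F = "(+)"])
  have "rec_nat n (\<lambda>_. Suc) m = m + n" for m n :: nat by (induction m) auto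
  moreover have "recl 2 (\<lambda>xs. rec_nat (xs ! 1) (\<lambda>_. Suc) (xs ! 0))"
    by (rule recl_prec1[where b = "\<lambda>x. x" and G = "\<lambda>_ _. Suc"]) (intro recl_intros; simp)+
  ultimately show "recl 2 (\<lambda>xs. xs ! 0 + xs ! 1)" by simp
qed

lemma recl_pred:
  assumes "recl k g" shows "recl k (\<lambda>xs. g xs - 1)"
proof (rule recl_comp1[OF _ assms, where F = "\<lambda>x. x - 1"])
  have "rec_nat 0 (\<lambda>n _. n) m = m - 1" for m :: nat by (cases m) auto
  moreover have "recl 1 (\<lambda>xs. rec_nat 0 (\<lambda>n _. n) (xs ! 0))"
    by (rule recl_prec0) (intro recl_intros; simp)+
  ultimately show "recl 1 (\<lambda>xs. xs ! 0 - 1)" by simp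
qed

lemma recl_diff [recl_intros]:
  assumes "recl k g" "recl k h" shows "recl k (\<lambda>xs. g xs - h xs)"
proof (rule recl_comp2[OF _ assms(2,1), where F = "\<lambda>m n. n - m"])
  have "rec_nat n (\<lambda>_ y. y - 1) m = n - m" for m n :: nat by (induction m) auto
  moreover have "recl 2 (\<lambda>xs. rec_nat (xs ! 1) (\<lambda>_ y. y - 1) (xs ! 0))"
    by (rule recl_prec1[where b = "\<lambda>x. x" and G = "\<lambda>_ _ y. y - 1"])
      (intro recl_intros recl_pred; simp)+
  ultimately show "recl 2 (\<lambda>xs. xs ! 1 - xs ! 0)" by simp
qed

lemma recl_triangle [recl_intros]:
  assumes "recl k g" shows "recl k (\<lambda>xs. triangle (g xs))"
proof (rule recl_comp1[OF _ assms, where F = triangle])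
  have "rec_nat 0 (\<lambda>n y. y + Suc n) m = triangle m" for m :: nat
    by (induction m) (auto simp del: triangle_def)
  moreover have "recl 1 (\<lambda>xs. rec_nat 0 (\<lambda>n y. y + Suc n) (xs ! 0))"
    by (rule recl_prec0) (intro recl_intros; simp)+
  ultimately show "recl 1 (\<lambda>xs. triangle (xs ! 0))" by simp
qed

text \<open>The index of the diagonal on which \<open>prod_decode n\<close> lies.\<close>

definition diagonal :: "nat \<Rightarrow> nat" where
  "diagonal = rec_nat 0 (\<lambda>n d. d + (1 - (triangle (Suc d) - Suc n)))"

text \<open>By truncated subtraction the increment in \<open>diagonal\<close> is 1 exactly when
  \<open>Suc n\<close> reaches the next triangular number, and 0 before that.\<close>

lemma diagonal_bounds: "triangle (diagonal n) \<le> n \<and> n < triangle (Suc (diagonal n))"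
proof (induction n)
  case (Suc n)
  have step: "diagonal (Suc n) = diagonal n + (1 - (triangle (Suc (diagonal n)) - Suc n))"
    by (simp add: diagonal_def)
  show ?case
  proof (cases "triangle (Suc (diagonal n)) = Suc n")
    case True
    then have "diagonal (Suc n) = Suc (diagonal n)" unfolding step by simp
    with True show ?thesis by simp
  next
    case False
    with Suc have "Suc n < triangle (Suc (diagonal n))" by linarith
    then have "diagonal (Suc n) = diagonal n" unfolding step by simp
    with Suc False show ?thesis by simp
  qed
qed (simp add: diagonal_def)

lemma prod_decode_diagonal:
  "prod_decode n = (n - triangle (diagonal n), diagonal n - (n - triangle (diagonal n)))"
proof -
  have "n - triangle (diagonal n) \<le> diagonal n" using diagonal_bounds[of n] by auto
  hence "prod_encode (n - triangle (diagonal n), diagonal n - (n - triangle (diagonal n))) = n"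
    using diagonal_bounds[of n] by (simp add: prod_encode_def)
  thus ?thesis by (metis prod_encode_inverse)
qed

lemma recl_diagonal [recl_intros]:
  assumes "recl k g" shows "recl k (\<lambda>xs. diagonal (g xs))"
proof (rule recl_comp1[OF _ assms, where F = diagonal])
  show "recl 1 (\<lambda>xs. diagonal (xs ! 0))" unfolding diagonal_def One_nat_def
    by (rule recl_prec0[unfolded One_nat_def]) (intro recl_intros; simp)+
qed

lemma recl_prod_encode [recl_intros]:
  "recl k f \<Longrightarrow> recl k g \<Longrightarrow> recl k (\<lambda>xs. prod_encode (f xs, g xs))"
  unfolding prod_encode_def prod.case by (intro recl_intros)

lemma recl_fst_prod_decode [recl_intros]:
  "recl k f \<Longrightarrow> recl k (\<lambda>xs. fst (prod_decode (f xs)))"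
  unfolding prod_decode_diagonal fst_conv by (intro recl_intros)

lemma recl_snd_prod_decode [recl_intros]:
  "recl k f \<Longrightarrow> recl k (\<lambda>xs. snd (prod_decode (f xs)))"
  unfolding prod_decode_diagonal snd_conv by (intro recl_intros)

lemma computable_iff_recl: "computable f \<longleftrightarrow> recl 1 (\<lambda>xs. f (xs ! 0))"
proof
  assume "computable f"
  then obtain r where "\<And>x. evals r [x] (f x)" unfolding computable_def by blast
  hence "evals r xs (f (xs ! 0))" if "length xs = 1" for xs
    using that by (cases xs) auto
  thus "recl 1 (\<lambda>xs. f (xs ! 0))" unfolding recl_def by blast
next
  assume "recl 1 (\<lambda>xs. f (xs ! 0))"
  then obtain r where "\<And>xs. length xs = 1 \<Longrightarrow> evals r xs (f (xs ! 0))"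
    unfolding recl_def by blast
  hence "\<And>x. evals r [x] (f x)" by (metis One_nat_def length_Cons list.size(3) nth_Cons_0)
  thus "computable f" unfolding computable_def by blast
qed

lemma recl_computable:
  "computable f \<Longrightarrow> recl k g \<Longrightarrow> recl k (\<lambda>xs. f (g xs))"
  unfolding computable_iff_recl by (rule recl_comp1)

lemma recl_iterate:
  assumes "computable f" "computable b"
  shows "recl 2 (\<lambda>xs. rec_nat (b (xs ! 1)) (\<lambda>_ y. f (prod_encode (y, xs ! 1))) (xs ! 0))"
  by (rule recl_prec1[where b = b and G = "\<lambda>p _ y. f (prod_encode (y, p))"])
    (intro recl_intros recl_computable[OF assms(1)] recl_computable[OF assms(2)]; simp)+

lemma computable_Least:
  assumes "computable f" and "\<And>x. \<exists>n. f (prod_encode (n, x)) = 0"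
  shows "computable (\<lambda>x. LEAST n. f (prod_encode (n, x)) = 0)"
proof -
  have "recl 2 (\<lambda>xs. f (prod_encode (xs ! 0, xs ! 1)))"
    by (intro recl_intros recl_computable[OF assms(1)]; simp)
  then obtain r where r: "\<And>xs. length xs = 2 \<Longrightarrow> evals r xs (f (prod_encode (xs ! 0, xs ! 1)))"
    unfolding recl_def by blast
  have "evals (Mu r) [x] (LEAST n. f (prod_encode (n, x)) = 0)" for x
  proof (rule evals_Mu)
    show "evals r [LEAST n. f (prod_encode (n, x)) = 0, x] 0"
      using r[of "[_, x]"] LeastI_ex[OF assms(2)] by (metis One_nat_def length_Cons list.size(3) nth_Cons_0 nth_Cons_Suc numeral_2_eq_2)
    show "\<forall>i<LEAST n. f (prod_encode (n, x)) = 0. \<exists>y. evals r [i, x] (Suc y)"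
    proof (intro allI impI)
      fix i assume "i < (LEAST n. f (prod_encode (n, x)) = 0)"
      hence "f (prod_encode (i, x)) \<noteq> 0" by (rule not_less_Least)
      then obtain y where "f (prod_encode (i, x)) = Suc y" using not0_implies_Suc by blast
      thus "\<exists>y. evals r [i, x] (Suc y)" using r[of "[i, x]"] by auto
    qed
  qed
  thus ?thesis unfolding computable_def by blast
qed

text \<open>Encodings are bijections with the numbers. So every number is a valid code, a search
  through all numbers is a search through the type, and \<open>enc\<close> and \<open>dec\<close>
  themselves count as recursive.\<close>

class coded =
  fixes enc :: "'a \<Rightarrow> nat" and dec :: "nat \<Rightarrow> 'a"
  assumes dec_enc [simp]: "dec (enc x) = x" and enc_dec [simp]: "enc (dec n) = n"
begin

lemma enc_eq_iff [simp]: "enc x = enc y \<longleftrightarrow> x = y"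
  by (metis dec_enc)

end

instantiation nat :: coded
begin
definition enc_nat :: "nat \<Rightarrow> nat" where [simp]: "enc_nat n = n"
definition dec_nat :: "nat \<Rightarrow> nat" where [simp]: "dec_nat n = n"
instance by standard auto
end

instantiation prod :: (coded, coded) coded
begin
definition enc_prod :: "'a \<times> 'b \<Rightarrow> nat" where
  "enc_prod p = prod_encode (enc (fst p), enc (snd p))"
definition dec_prod :: "nat \<Rightarrow> 'a \<times> 'b" where
  "dec_prod n = (dec (fst (prod_decode n)), dec (snd (prod_decode n)))"
instance by standard (auto simp: enc_prod_def dec_prod_def)
end

instantiation list :: (coded) coded
begin
definition enc_list :: "'a list \<Rightarrow> nat" where
  "enc_list xs = list_encode (map enc xs)"
definition dec_list :: "nat \<Rightarrow> 'a list" where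
  "dec_list n = map dec (list_decode n)"
instance by standard (auto simp: enc_list_def dec_list_def comp_def)
end

section \<open>Recursive functions and decidable predicates on coded types\<close>

definition rec_fun :: "('a::coded \<Rightarrow> 'b::coded) \<Rightarrow> bool" where
  "rec_fun f \<longleftrightarrow> computable (\<lambda>n. enc (f (dec n)))"

definition decidable :: "('a::coded \<Rightarrow> bool) \<Rightarrow> bool" where
  "decidable P \<longleftrightarrow> rec_fun (\<lambda>x. if P x then 1 else 0 :: nat)"

lemma rec_fun_nat: "rec_fun f \<longleftrightarrow> computable (f :: nat \<Rightarrow> nat)"
  by (simp add: rec_fun_def)

named_theorems rec_intros

lemma rec_fun_id [rec_intros]: "rec_fun (\<lambda>x. x)"
  unfolding rec_fun_def computable_iff_recl enc_dec by (intro recl_intros) simp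

lemma recl_const: "recl k (\<lambda>xs. c)"
  by (induction c) (intro recl_intros; simp)+

lemma rec_fun_const [rec_intros]: "rec_fun (\<lambda>x. c)"
  unfolding rec_fun_def computable_iff_recl by (rule recl_const)

lemma rec_fun_comp:
  assumes "rec_fun f" "rec_fun g" shows "rec_fun (\<lambda>x. f (g x))"
proof -
  have "recl 1 (\<lambda>xs. enc (f (dec (enc (g (dec (xs ! 0)))))))"
    using assms unfolding rec_fun_def
    by (intro recl_computable[of "\<lambda>n. enc (f (dec n))"]) (simp_all add: computable_iff_recl)
  thus ?thesis unfolding rec_fun_def computable_iff_recl by simp
qed

lemma rec_fun_Pair [rec_intros]:
  "rec_fun f \<Longrightarrow> rec_fun g \<Longrightarrow> rec_fun (\<lambda>x. (f x, g x))"
  unfolding rec_fun_def computable_iff_recl enc_prod_def fst_conv snd_conv by (rule recl_prod_encode)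

lemma rec_fun_fst [rec_intros]: "rec_fun f \<Longrightarrow> rec_fun (\<lambda>x. fst (f x))"
proof (rule rec_fun_comp[where f = fst])
  show "rec_fun (fst :: 'b \<times> 'c \<Rightarrow> 'b)"
    unfolding rec_fun_def computable_iff_recl dec_prod_def fst_conv enc_dec
    by (intro recl_intros) simp
qed

lemma rec_fun_snd [rec_intros]: "rec_fun f \<Longrightarrow> rec_fun (\<lambda>x. snd (f x))"
proof (rule rec_fun_comp[where f = snd])
  show "rec_fun (snd :: 'b \<times> 'c \<Rightarrow> 'c)"
    unfolding rec_fun_def computable_iff_recl dec_prod_def snd_conv enc_dec
    by (intro recl_intros) simp
qed

text \<open>Since \<open>rec_fun\<close> speaks of functions of one argument, a binary function is
  first taken on pairs, through the projections.\<close>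

lemma rec_fun_comp2:
  assumes "rec_fun (\<lambda>p. F (fst p) (snd p))" "rec_fun g" "rec_fun h"
  shows "rec_fun (\<lambda>x. F (g x) (h x))"
  using rec_fun_comp[OF assms(1) rec_fun_Pair[OF assms(2,3)]] by simp

lemma rec_fun_enc [rec_intros]: "rec_fun f \<Longrightarrow> rec_fun (\<lambda>x. enc (f x))"
  unfolding rec_fun_def by simp

lemma rec_fun_dec [rec_intros]: "rec_fun f \<Longrightarrow> rec_fun (\<lambda>x. dec (f x))"
  unfolding rec_fun_def by simp

lemma rec_fun_Suc [rec_intros]: "rec_fun f \<Longrightarrow> rec_fun (\<lambda>x. Suc (f x))"
  unfolding rec_fun_def enc_nat_def computable_iff_recl by (rule recl_Suc)

lemma rec_fun_add [rec_intros]: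
  "rec_fun f \<Longrightarrow> rec_fun g \<Longrightarrow> rec_fun (\<lambda>x. f x + g x :: nat)"
  unfolding rec_fun_def enc_nat_def computable_iff_recl by (rule recl_add)

lemma rec_fun_diff [rec_intros]:
  "rec_fun f \<Longrightarrow> rec_fun g \<Longrightarrow> rec_fun (\<lambda>x. f x - g x :: nat)"
  unfolding rec_fun_def enc_nat_def computable_iff_recl by (rule recl_diff)

text \<open>The form of primitive recursion used from here on: a step function with fixed parameter
  \<open>x\<close> is iterated. Case distinctions, folds and bounded quantifiers are instances of
  it.\<close>

lemma rec_fun_iterate [rec_intros]:
  fixes h :: "'e::coded \<Rightarrow> 'a::coded \<Rightarrow> 'a"
  assumes "rec_fun (\<lambda>p. h (fst p) (snd p))" "rec_fun n" "rec_fun g"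
  shows "rec_fun (\<lambda>x. (h x ^^ n x) (g x))"
proof -
  define f where "f m = enc ((\<lambda>p. h (snd p) (fst p)) (dec m))" for m
  have "rec_fun (\<lambda>p. h (snd p) (fst p))"
    by (rule rec_fun_comp2[OF assms(1)]) (intro rec_intros)+
  hence f: "computable f" unfolding f_def rec_fun_def .
  have f_enc: "f (prod_encode (enc y, p)) = enc (h (dec p) y)" for y p
    unfolding f_def by (simp add: dec_prod_def)
  have it: "rec_nat (enc (g (dec p))) (\<lambda>_ y. f (prod_encode (y, p))) m
      = enc ((h (dec p) ^^ m) (g (dec p)))" for p m
    by (induction m) (simp_all add: f_enc)
  have "recl 2 (\<lambda>xs. enc ((h (dec (xs ! 1)) ^^ (xs ! 0)) (g (dec (xs ! 1)))))"
    using recl_iterate[OF f assms(3)[unfolded rec_fun_def]] unfolding it .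
  from recl_comp2[OF this, of 1 "\<lambda>xs. n (dec (xs ! 0))" "\<lambda>xs. xs ! 0"]
  show ?thesis using assms(2)
    by (simp add: rec_fun_def computable_iff_recl recl_proj)
qed

text \<open>In the \<open>Mu\<close> case, of two different results the smaller one would give the
  searched function both the value 0 and a positive value. The other cases unfold one computation
  step and use the induction hypotheses.\<close>

lemma evals_det: "evals r xs y \<Longrightarrow> evals r xs z \<Longrightarrow> y = z"
proof (induction arbitrary: z rule: evals.induct)
  case (evals_Comp xs gs ys f y)
  from evals_Comp.prems obtain ys' where ys': "list_all2 (\<lambda>g y. evals g xs y) gs ys'" "evals f ys' z"
    by (cases rule: evals.cases) auto
  have "ys = ys'"
    using evals_Comp.IH(1) ys'(1) by (auto simp: list_all2_conv_all_nth intro: nth_equalityI)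
  thus ?case using evals_Comp.IH(2) ys'(2) by blast
next
  case (evals_Prec_Suc f g n xs y w)
  from evals_Prec_Suc.prems obtain y' where "evals (Prec f g) (n # xs) y'" "evals g (n # y' # xs) z"
    by (cases rule: evals.cases) auto
  thus ?case using evals_Prec_Suc.IH by blast
next
  case (evals_Mu f n xs)
  from evals_Mu.prems have z: "evals f (z # xs) 0" "\<forall>i<z. \<exists>y. evals f (i # xs) (Suc y)"
    by (cases rule: evals.cases; auto)+
  show ?case
  proof (rule linorder_cases[of n z])
    assume "n < z"
    then obtain y where "evals f (n # xs) (Suc y)" using z(2) by blast
    thus ?thesis using evals_Mu.IH(1) by blast
  next
    assume "z < n"
    then obtain y where "\<forall>w. evals f (z # xs) w \<longrightarrow> Suc y = w" using evals_Mu.IH(2) by blast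
    thus ?thesis using z(1) by blast
  qed
next
  case (evals_Zero xs)
  thus ?case by (cases rule: evals.cases) auto
next
  case (evals_Succ x)
  thus ?case by (cases rule: evals.cases) auto
next
  case (evals_Proj i xs)
  from evals_Proj.prems show ?case by (cases rule: evals.cases) auto
next
  case (evals_Prec_0 f xs y g)
  from evals_Prec_0.prems have "evals f xs z" by (cases rule: evals.cases) auto
  thus ?case using evals_Prec_0.IH by blast
qed

lemma rec_fun_if [rec_intros]:
  assumes "decidable P" "rec_fun f" "rec_fun g"
  shows "rec_fun (\<lambda>x. if P x then f x else g x)"
proof -
  \<comment> \<open>A case distinction is the iteration of a constant function, carried out once or
    not at all.\<close>
  have "rec_fun (\<lambda>x. ((\<lambda>_. f x) ^^ (if P x then 1 else 0 :: nat)) (g x))"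
    using rec_fun_comp[OF assms(2) rec_fun_fst[OF rec_fun_id]] assms(1)[unfolded decidable_def] assms(3)
    by (rule rec_fun_iterate[where h = "\<lambda>x _. f x"])
  thus ?thesis by (rule back_subst[where P = rec_fun]) auto
qed

lemma decidable_comp: "decidable P \<Longrightarrow> rec_fun f \<Longrightarrow> decidable (\<lambda>x. P (f x))"
  unfolding decidable_def by (rule rec_fun_comp[where g = f])

lemma decidable_comp2:
  assumes "decidable (\<lambda>p. P (fst p) (snd p))" "rec_fun g" "rec_fun h"
  shows "decidable (\<lambda>x. P (g x) (h x))"
  using decidable_comp[OF assms(1) rec_fun_Pair[OF assms(2,3)]] by simp

lemma decidable_comp3:
  assumes "decidable (\<lambda>p. P (fst p) (fst (snd p)) (snd (snd p)))"
    "rec_fun f" "rec_fun g" "rec_fun h"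
  shows "decidable (\<lambda>x. P (f x) (g x) (h x))"
  using decidable_comp[OF assms(1) rec_fun_Pair[OF assms(2) rec_fun_Pair[OF assms(3,4)]]] by simp

lemma decidable_const [rec_intros]: "decidable (\<lambda>x. c)"
  unfolding decidable_def by (rule rec_fun_const)

lemma decidable_not [rec_intros]: "decidable P \<Longrightarrow> decidable (\<lambda>x. \<not> P x)"
  unfolding decidable_def
  by (rule back_subst[where P = rec_fun], rule rec_fun_diff[OF rec_fun_const[of 1]], assumption) auto

lemma decidable_if [rec_intros]:
  assumes "decidable P" "decidable Q" "decidable R"
  shows "decidable (\<lambda>x. if P x then Q x else R x)"
  using rec_fun_if[OF assms(1) assms(2,3)[unfolded decidable_def]] unfolding decidable_def
  by (rule back_subst[where P = rec_fun]) auto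

lemma decidable_conj [rec_intros]: "decidable P \<Longrightarrow> decidable Q \<Longrightarrow> decidable (\<lambda>x. P x \<and> Q x)"
  using decidable_if[of P Q "\<lambda>_. False", OF _ _ decidable_const]
  by (rule back_subst[where P = decidable]) auto

lemma decidable_imp [rec_intros]: "decidable P \<Longrightarrow> decidable Q \<Longrightarrow> decidable (\<lambda>x. P x \<longrightarrow> Q x)"
  using decidable_if[of P Q "\<lambda>_. True", OF _ _ decidable_const]
  by (rule back_subst[where P = decidable]) auto

lemma decidable_iff [rec_intros]: "decidable P \<Longrightarrow> decidable Q \<Longrightarrow> decidable (\<lambda>x. P x \<longleftrightarrow> Q x)"
  unfolding iff_conv_conj_imp by (intro rec_intros)

lemma decidable_eq_0: "rec_fun f \<Longrightarrow> decidable (\<lambda>x. f x = (0 :: nat))"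
  unfolding decidable_def
  by (rule back_subst[where P = rec_fun], rule rec_fun_diff[OF rec_fun_const[of 1]], assumption) auto

lemma decidable_le [rec_intros]: "rec_fun f \<Longrightarrow> rec_fun g \<Longrightarrow> decidable (\<lambda>x. f x \<le> (g x :: nat))"
  using decidable_eq_0[OF rec_fun_diff] by fastforce

lemma decidable_less [rec_intros]: "rec_fun f \<Longrightarrow> rec_fun g \<Longrightarrow> decidable (\<lambda>x. f x < (g x :: nat))"
  using decidable_le[OF rec_fun_Suc] by (simp add: Suc_le_eq)

text \<open>Equality in any coded type is comparison of codes, by injectivity of
  \<open>enc\<close>.\<close>

lemma decidable_eq [rec_intros]: "rec_fun f \<Longrightarrow> rec_fun g \<Longrightarrow> decidable (\<lambda>x. f x = g x)"
  using decidable_conj[of "\<lambda>x. enc (f x) \<le> enc (g x)" "\<lambda>x. enc (g x) \<le> enc (f x)"]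
  by (simp flip: order_eq_iff add: decidable_le rec_fun_enc)

lemma rec_fun_double [rec_intros]: "rec_fun f \<Longrightarrow> rec_fun (\<lambda>x. 2 * f x :: nat)"
  unfolding mult_2 by (intro rec_intros)

lemma decidable_even [rec_intros]: "rec_fun f \<Longrightarrow> decidable (\<lambda>x. even (f x :: nat))"
proof (rule decidable_comp[where P = even])
  have "((\<lambda>b. 1 - b) ^^ n) 1 = (if even n then 1 else 0 :: nat)" for n by (induction n) auto
  moreover have "rec_fun (\<lambda>n. ((\<lambda>b. 1 - b) ^^ n) (1 :: nat))"
    by (rule rec_fun_iterate[where h = "\<lambda>_ b. 1 - b"]) (intro rec_intros)+
  ultimately show "decidable (even :: nat \<Rightarrow> bool)" unfolding decidable_def by simp
qed

lemma rec_fun_mod [rec_intros]: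
  assumes "rec_fun f" shows "rec_fun (\<lambda>x. f x mod n :: nat)"
proof (cases "n = 0")
  case False
  show ?thesis
  proof (rule rec_fun_comp[OF _ assms])
    have "((\<lambda>r. if Suc r = n then 0 else Suc r) ^^ m) 0 = m mod n" for m
      using False by (induction m) (auto simp: mod_Suc)
    moreover have "rec_fun (\<lambda>m. ((\<lambda>r. if Suc r = n then 0 else Suc r) ^^ m) 0)"
      by (rule rec_fun_iterate[where h = "\<lambda>_ r. if Suc r = n then 0 else Suc r"]) (intro rec_intros)+
    ultimately show "rec_fun (\<lambda>m. m mod n)" by simp
  qed
qed (use assms in simp)

lemma rec_fun_half [rec_intros]:
  assumes "rec_fun f" shows "rec_fun (\<lambda>x. f x div 2 :: nat)"
proof (rule rec_fun_comp[OF _ assms])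
  have "((\<lambda>p. (snd p, Suc (fst p))) ^^ m) (0, 0) = (m div 2, Suc m div 2)" for m
    by (induction m) auto
  moreover have "rec_fun (\<lambda>m. fst (((\<lambda>p. (snd p, Suc (fst p))) ^^ m) (0 :: nat, 0 :: nat)))"
    by (intro rec_intros)
  ultimately show "rec_fun (\<lambda>m. m div 2 :: nat)" by simp
qed

section \<open>Recursive list operations\<close>

lemma enc_Cons: "enc (x # xs) = Suc (enc (x, xs))"
  by (simp add: enc_list_def enc_prod_def)

lemma length_le_enc: "length xs \<le> enc xs"
proof (induction xs)
  case (Cons x xs)
  thus ?case using le_prod_encode_2[of "enc xs" "enc x"] by (simp add: enc_Cons enc_prod_def)
qed simp

lemma dec_enc_list: "xs \<noteq> [] \<Longrightarrow> dec (enc xs - 1) = (hd xs, tl xs)"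
  by (cases xs) (auto simp: enc_Cons)

lemma rec_fun_Cons [rec_intros]: 
  assumes "rec_fun f" "rec_fun g" shows "rec_fun (\<lambda>x. f x # g x)"
proof -
  have "rec_fun (\<lambda>x. dec (Suc (enc (f x, g x))) :: 'b list)" by (intro rec_intros assms)
  thus ?thesis by (simp flip: enc_Cons)
qed

lemma rec_fun_hd [rec_intros]: "rec_fun f \<Longrightarrow> rec_fun (\<lambda>x. hd (f x))"
proof (rule rec_fun_comp[where f = hd])
  \<comment> \<open>The value \<open>hd []\<close> is unspecified but fixed, so the empty case is a
    constant function.\<close>
  have "rec_fun (\<lambda>xs :: 'b list. if xs = [] then hd [] else fst (dec (enc xs - 1) :: 'b \<times> 'b list))"
    by (intro rec_intros)
  moreover have "(if xs = [] then hd [] else fst (dec (enc xs - 1) :: 'b \<times> 'b list)) = hd xs" for xs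
    using dec_enc_list[of xs] by simp
  ultimately show "rec_fun (hd :: 'b list \<Rightarrow> 'b)" by simp
qed

lemma rec_fun_tl [rec_intros]: "rec_fun f \<Longrightarrow> rec_fun (\<lambda>x. tl (f x))"
proof (rule rec_fun_comp[where f = tl])
  have "rec_fun (\<lambda>xs :: 'b list. if xs = [] then [] else snd (dec (enc xs - 1) :: 'b \<times> 'b list))"
    by (intro rec_intros)
  moreover have "(if xs = [] then [] else snd (dec (enc xs - 1) :: 'b \<times> 'b list)) = tl xs" for xs
    using dec_enc_list[of xs] by simp
  ultimately show "rec_fun (tl :: 'b list \<Rightarrow> 'b list)" by simp
qed

text \<open>The fold consumes one list entry per iteration. The code of the list bounds its length,
  so it can serve as the number of iterations before \<open>length\<close> is known to be recursive;
  surplus iterations find an empty list and change nothing.\<close>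

lemma rec_fun_foldl [rec_intros]:
  fixes f :: "'e::coded \<Rightarrow> 'a::coded \<Rightarrow> 'b::coded \<Rightarrow> 'a"
  assumes "rec_fun (\<lambda>p. f (fst p) (fst (snd p)) (snd (snd p)))" "rec_fun a" "rec_fun l"
  shows "rec_fun (\<lambda>x. foldl (f x) (a x) (l x))"
proof -
  define h where "h x p = (if fst p = [] then p else (tl (fst p), f x (snd p) (hd (fst p))))" for x p
  have step: "(h x ^^ n) (xs, y) = (drop n xs, foldl (f x) y (take n xs))" for x n xs y
  proof (induction n)
    case (Suc n)
    show ?case
    proof (cases "n < length xs")
      case True
      thus ?thesis using Suc
        by (simp add: h_def tl_drop drop_Suc hd_drop_conv_nth take_Suc_conv_app_nth)
    qed (use Suc in \<open>simp add: h_def\<close>)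
  qed simp
  have f': "rec_fun (\<lambda>x. f (g x) (h x) (k x))" if "rec_fun g" "rec_fun h" "rec_fun k"
    for g :: "('e \<times> 'b list \<times> 'a) \<Rightarrow> 'e" and h k
    using rec_fun_comp[OF assms(1) rec_fun_Pair[OF that(1) rec_fun_Pair[OF that(2,3)]]] by simp
  have "rec_fun (\<lambda>x. snd ((h x ^^ enc (l x)) (l x, a x)))"
    unfolding h_def by (intro rec_intros assms f')
  thus ?thesis by (simp add: step length_le_enc)
qed

lemma rec_fun_rev [rec_intros]: "rec_fun l \<Longrightarrow> rec_fun (\<lambda>x. rev (l x))"
proof -
  assume l: "rec_fun l"
  have "rec_fun (\<lambda>x. foldl (\<lambda>a y. y # a) [] (l x))" by (intro rec_intros l)
  moreover have "foldl (\<lambda>a y. y # a) ys xs = rev xs @ ys" for xs ys :: "'b list"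
    by (induction xs arbitrary: ys) auto
  ultimately show ?thesis by simp
qed

lemma rec_fun_append [rec_intros]:
  assumes "rec_fun l" "rec_fun k" shows "rec_fun (\<lambda>x. l x @ k x)"
proof -
  have "rec_fun (\<lambda>x. foldl (\<lambda>a y. y # a) (k x) (rev (l x)))" by (intro rec_intros assms)
  moreover have "foldl (\<lambda>a y. y # a) ys (rev xs) = xs @ ys" for xs ys :: "'b list"
    by (induction xs arbitrary: ys) auto
  ultimately show ?thesis by simp
qed

lemma rec_fun_length [rec_intros]:
  assumes "rec_fun l" shows "rec_fun (\<lambda>x. length (l x))"
proof -
  have "rec_fun (\<lambda>x. foldl (\<lambda>a y. Suc a) 0 (l x))" by (intro rec_intros assms)
  moreover have "foldl (\<lambda>a y. Suc a) n xs = n + length xs" for n and xs :: "'b list"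
    by (induction xs arbitrary: n) auto
  ultimately show ?thesis by simp
qed

lemma rec_fun_drop [rec_intros]:
  assumes "rec_fun n" "rec_fun l" shows "rec_fun (\<lambda>x. drop (n x) (l x))"
proof -
  have "rec_fun (\<lambda>x. (tl ^^ n x) (l x))" by (intro rec_intros assms)
  moreover have "(tl ^^ n) xs = drop n xs" for n and xs :: "'b list"
    by (induction n) (auto simp: drop_Suc tl_drop)
  ultimately show ?thesis by simp
qed

lemma rec_fun_filter_rev:
  fixes P :: "'e::coded \<Rightarrow> 'a::coded \<Rightarrow> bool"
  assumes "decidable (\<lambda>p. P (fst p) (snd p))" "rec_fun l"
  shows "rec_fun (\<lambda>x. filter (P x) (rev (l x)))"
proof -
  have P: "decidable (\<lambda>x. P (g x) (h x))" if "rec_fun g" "rec_fun h" for g :: "'e \<times> 'a list \<times> 'a \<Rightarrow> 'e" and h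
    using decidable_comp2[OF assms(1) that] .
  have "rec_fun (\<lambda>x. foldl (\<lambda>a y. if P x y then y # a else a) [] (l x))"
    by (intro rec_intros assms P)
  moreover have "foldl (\<lambda>a y. if P x y then y # a else a) ys xs = filter (P x) (rev xs) @ ys" for x xs ys
    by (induction xs arbitrary: ys) auto
  ultimately show ?thesis by simp
qed

lemma rec_fun_filter [rec_intros]:
  assumes "decidable (\<lambda>p. P (fst p) (snd p))" "rec_fun l"
  shows "rec_fun (\<lambda>x. filter (P x) (l x))"
  using rec_fun_filter_rev[OF assms(1) rec_fun_rev[OF assms(2)]] by simp

lemma rec_fun_map_snd [rec_intros]:
  assumes "rec_fun l" shows "rec_fun (\<lambda>x. map snd (l x))"
proof -
  have "rec_fun (\<lambda>x. rev (foldl (\<lambda>a y. snd y # a) [] (l x)))" by (intro rec_intros assms)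
  moreover have "foldl (\<lambda>a y. snd y # a) ys xs = rev (map snd xs) @ ys" for ys and xs :: "('b \<times> 'c) list"
    by (induction xs arbitrary: ys) auto
  ultimately show ?thesis by simp
qed

lemma decidable_bex [rec_intros]:
  assumes "decidable (\<lambda>p. P (fst p) (snd p))" "rec_fun l"
  shows "decidable (\<lambda>x. \<exists>y\<in>set (l x). P x y)"
proof -
  have "decidable (\<lambda>x. filter (P x) (l x) \<noteq> [])" by (intro rec_intros assms)
  thus ?thesis by (simp add: filter_empty_conv)
qed

lemma decidable_ball_less [rec_intros]:
  fixes P :: "'e::coded \<Rightarrow> nat \<Rightarrow> bool"
  assumes "decidable (\<lambda>p. P (fst p) (snd p))" "rec_fun n"
  shows "decidable (\<lambda>x. \<forall>i<n x. P x i)"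
proof -
  define h where "h x p = (Suc (fst p), if P x (fst p) then snd p else (0::nat))" for x p
  have h: "(h x ^^ m) (0, 1) = (m, if \<forall>i<m. P x i then 1 else 0)" for x m
    by (induction m) (auto simp: h_def less_Suc_eq)
  have P: "decidable (\<lambda>x. P (g x) (h x))" if "rec_fun g" "rec_fun h" for g :: "'e \<times> nat \<times> nat \<Rightarrow> 'e" and h
    using decidable_comp2[OF assms(1) that] .
  have "rec_fun (\<lambda>x. snd ((h x ^^ n x) (0, 1)))"
    unfolding h_def by (intro rec_intros assms P)
  thus ?thesis by (simp only: h decidable_def snd_conv)
qed

text \<open>Minimisation over the codes of witnesses. It turns "some stage and some witness exist"
  into a recursive choice of them, which is how the reductions below are obtained.\<close>

lemma rec_search:
  fixes P :: "'a::coded \<Rightarrow> 'b::coded \<Rightarrow> bool"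
  assumes P: "decidable (\<lambda>p. P (fst p) (snd p))" and ex: "\<And>x. \<exists>w. P x w"
  obtains g where "rec_fun g" "\<And>x. P x (g x)"
proof
  define f where "f p = (if P (snd p) (fst p) then 0 else 1::nat)" for p :: "'b \<times> 'a"
  have "rec_fun f" unfolding f_def by (intro rec_intros decidable_comp2[OF P])
  hence f: "computable (\<lambda>n. f (dec n))" by (simp add: rec_fun_def)
  have eq: "f (dec (prod_encode (n, x))) = 0 \<longleftrightarrow> P (dec x) (dec n)" for n x
    by (simp add: f_def dec_prod_def)
  have ex': "\<exists>n. P (dec x) (dec n)" for x
    using ex[of "dec x"] dec_enc by metis
  have "computable (\<lambda>x. LEAST n. P (dec x) (dec n))"
    using computable_Least[OF f, unfolded eq, OF ex'] .
  thus "rec_fun (\<lambda>x. dec (LEAST n. P x (dec n)) :: 'b)" by (simp add: rec_fun_def)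
  show "P x (dec (LEAST n. P x (dec n)))" for x
    using LeastI_ex[OF ex', of "enc x"] by simp
qed

text \<open>The code \<open>r\<close> gives 0 on witnesses and 1 on everything else, so the search
  \<open>Mu r\<close> always proceeds and halts exactly if there is a witness. Determinism shows
  that a zero found by \<open>Mu\<close> comes from a true instance of \<open>P\<close>.\<close>

lemma ce_rel_Ex:
  fixes P :: "'a::coded \<Rightarrow> nat \<Rightarrow> nat \<Rightarrow> bool"
  assumes P: "decidable (\<lambda>p. P (fst p) (fst (snd p)) (snd (snd p)))"
  shows "ce_rel {(x, y). \<exists>w. P w x y}"
proof -
  define f where "f p = (if P (fst p) (fst (snd p)) (snd (snd p)) then 0 else 1::nat)" for p :: "'a \<times> nat \<times> nat"
  have "rec_fun f" unfolding f_def by (intro rec_intros P)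
  hence f: "computable (\<lambda>n. f (dec n))" by (simp add: rec_fun_def)
  have "recl 3 (\<lambda>xs. f (dec (prod_encode (xs ! 0, prod_encode (xs ! 1, xs ! 2)))))"
    by (intro recl_computable[OF f] recl_intros) auto
  then obtain r where r: "\<And>xs. length xs = 3 \<Longrightarrow> 
      evals r xs (f (dec (prod_encode (xs ! 0, prod_encode (xs ! 1, xs ! 2)))))"
    unfolding recl_def by blast
  have eq: "f (dec (prod_encode (n, prod_encode (x, y)))) = (if P (dec n) x y then 0 else 1)" for n x y
    by (simp add: f_def dec_prod_def)
  have r: "evals r [n, x, y] (if P (dec n) x y then 0 else 1)" for n x y
    using r[of "[n, x, y]"] by (simp add: eq)
  have "(\<exists>w. P w x y) \<longleftrightarrow> (\<exists>z. evals (Mu r) [x, y] z)" for x y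
  proof
    assume "\<exists>w. P w x y"
    hence ex: "\<exists>n. P (dec n) x y" by (metis dec_enc)
    have "evals (Mu r) [x, y] (LEAST n. P (dec n) x y)"
    proof (rule evals_Mu)
      show "evals r [LEAST n. P (dec n) x y, x, y] 0"
        using r[of "LEAST n. P (dec n) x y" x y] LeastI_ex[OF ex] by simp
      show "\<forall>i<LEAST n. P (dec n) x y. \<exists>z. evals r [i, x, y] (Suc z)"
      proof (intro allI impI)
        fix i assume "i < (LEAST n. P (dec n) x y)"
        hence "\<not> P (dec i) x y" by (rule not_less_Least)
        thus "\<exists>z. evals r [i, x, y] (Suc z)" using r[of i x y] by auto
      qed
    qed
    thus "\<exists>z. evals (Mu r) [x, y] z" by blast
  next
    assume "\<exists>z. evals (Mu r) [x, y] z"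
    then obtain z where "evals r [z, x, y] 0" by (auto elim: evals.cases)
    from evals_det[OF this r] show "\<exists>w. P w x y" by (auto split: if_splits)
  qed
  thus ?thesis unfolding ce_rel_def by auto
qed

section \<open>Enumeration of all convergent computations\<close>

lemma rec_fun_primrec:
  assumes "rec_fun (\<lambda>p. h (fst p) (snd p))" "\<And>n. f (Suc n) = h n (f n)"
  shows "rec_fun (f :: nat \<Rightarrow> 'a::coded)"
proof -
  have "((\<lambda>p. (Suc (fst p), h (fst p) (snd p))) ^^ n) (0, f 0) = (n, f n)" for n
    by (induction n) (auto simp: assms(2))
  moreover have "rec_fun (\<lambda>n. snd (((\<lambda>p. (Suc (fst p), h (fst p) (snd p))) ^^ n) (0, f 0)))"
    by (intro rec_intros rec_fun_comp2[OF assms(1)])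
  ultimately show ?thesis by simp
qed

lemma decidable_mem [rec_intros]:
  assumes "rec_fun f" "rec_fun l" shows "decidable (\<lambda>x. f x \<in> set (l x))"
proof -
  have "decidable (\<lambda>x. \<exists>y\<in>set (l x). y = f x)"
    by (intro rec_intros assms[THEN rec_fun_comp])
  thus ?thesis by simp
qed

text \<open>The second component of the decoded pair is padding: it makes every value of the first
  component recur at arbitrarily late stages, so each instruction is scheduled again and
  again.\<close>

lemma dec_infinitely_often:
  obtains s where "s \<ge> N" "fst (dec s :: 'a::coded \<times> nat) = a"
proof
  show "enc (a, N) \<ge> N" using le_prod_encode_2[of N "enc a"] by (simp add: enc_prod_def)
qed simp

lemma enc_Pair_eq_iff:
  "enc (a, b) = enc (c, d) \<longleftrightarrow> enc a = enc c \<and> enc b = enc d"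
  by (simp add: enc_prod_def)

type_synonym fact = "nat \<times> nat list \<times> nat"

text \<open>The leading tag separates the constructors. An injection into the numbers suffices for
  codes, so some numbers code nothing and no instance of \<open>coded\<close> is needed.\<close>

primrec recf_enc :: "recf \<Rightarrow> nat" where
  "recf_enc Zero = enc (0 :: nat, 0 :: nat)"
| "recf_enc Succ = enc (1 :: nat, 0 :: nat)"
| "recf_enc (Proj i) = enc (2 :: nat, i)"
| "recf_enc (Comp f gs) = enc (3 :: nat, recf_enc f, map recf_enc gs)"
| "recf_enc (Prec f g) = enc (4 :: nat, recf_enc f, recf_enc g)"
| "recf_enc (Mu f) = enc (5 :: nat, recf_enc f)"

text \<open>Keeping at most one value for each code and argument list makes the enumerated
  functions single-valued even for numbers that are not codes.\<close>

definition add_fact :: "fact \<Rightarrow> fact list \<Rightarrow> fact list" where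
  "add_fact F D = (if \<exists>G\<in>set D. fst G = fst F \<and> fst (snd G) = fst (snd F) then D else D @ [F])"

text \<open>One attempt at forward chaining: \<open>t\<close> selects an introduction rule of
  \<open>evals\<close>, the other arguments guess its instance, and the premises are looked up among
  the facts already derived. A failed attempt leaves \<open>D\<close> alone. As \<open>Prec\<close>
  has two rules, 4 and 5, the number of the rule for \<open>Mu\<close> is one ahead of its
  constructor tag.\<close>

definition apply_rule :: "nat \<Rightarrow> nat \<Rightarrow> nat \<Rightarrow> nat list \<Rightarrow> nat \<Rightarrow> nat list \<Rightarrow> nat list \<Rightarrow> nat \<Rightarrow> nat
    \<Rightarrow> fact list \<Rightarrow> fact list" where
  "apply_rule t f g gs n xs ys y z D =
    (if t = 0 then add_fact (enc (0 :: nat, 0 :: nat), xs, 0) D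
     else if t = 1 then add_fact (enc (1 :: nat, 0 :: nat), [y], Suc y) D
     else if t = 2 then
       (if n < length xs then add_fact (enc (2 :: nat, n), xs, hd (drop n xs)) D else D)
     else if t = 3 then
       (if length gs = length ys \<and> (\<forall>i<length gs. (hd (drop i gs), xs, hd (drop i ys)) \<in> set D)
          \<and> (f, ys, z) \<in> set D
        then add_fact (enc (3 :: nat, f, gs), xs, z) D else D)
     else if t = 4 then
       (if (f, xs, y) \<in> set D then add_fact (enc (4 :: nat, f, g), 0 # xs, y) D else D)
     else if t = 5 then
       (if (enc (4 :: nat, f, g), n # xs, y) \<in> set D \<and> (g, n # y # xs, z) \<in> set D
        then add_fact (enc (4 :: nat, f, g), Suc n # xs, z) D else D)
     else
       (if (f, n # xs, 0) \<in> set D \<and>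
          (\<forall>i<n. \<exists>G\<in>set D. fst G = f \<and> fst (snd G) = i # xs \<and> snd (snd G) \<noteq> 0)
        then add_fact (enc (5 :: nat, f), xs, n) D else D))"

lemma rec_fun_add_fact [rec_intros]:
  assumes "rec_fun F" "rec_fun D" shows "rec_fun (\<lambda>x. add_fact (F x) (D x))"
  unfolding add_fact_def by (intro rec_intros assms[THEN rec_fun_comp])

lemma rec_fun_apply_rule [rec_intros]:
  assumes "rec_fun t" "rec_fun f" "rec_fun g" "rec_fun gs" "rec_fun n" "rec_fun xs" "rec_fun ys"
    "rec_fun y" "rec_fun z" "rec_fun D"
  shows "rec_fun (\<lambda>x. apply_rule (t x) (f x) (g x) (gs x) (n x) (xs x) (ys x) (y x) (z x) (D x))"
  unfolding apply_rule_def by (intro rec_intros assms[THEN rec_fun_comp])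

type_synonym rule_inst =
  "nat \<times> nat \<times> nat \<times> nat list \<times> nat \<times> nat list \<times> nat list \<times> nat \<times> nat"

definition apply_inst :: "rule_inst \<Rightarrow> fact list \<Rightarrow> fact list" where
  "apply_inst p = apply_rule (fst p) (fst (snd p)) (fst (snd (snd p))) (fst (snd (snd (snd p))))
     (fst (snd (snd (snd (snd p))))) (fst (snd (snd (snd (snd (snd p))))))
     (fst (snd (snd (snd (snd (snd (snd p)))))))
     (fst (snd (snd (snd (snd (snd (snd (snd p))))))))
     (snd (snd (snd (snd (snd (snd (snd (snd p))))))))"

lemma apply_inst_simp [simp]:
  "apply_inst (t, f, g, gs, n, xs, ys, y, z) = apply_rule t f g gs n xs ys y z"
  by (simp add: apply_inst_def)

text \<open>Stage \<open>s\<close> tries the rule instance coded by \<open>s\<close>; the padding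
  component lets the same instance be tried again once its premises have appeared.\<close>

primrec facts :: "nat \<Rightarrow> fact list" where
  "facts 0 = []"
| "facts (Suc s) = apply_inst (fst (dec s :: rule_inst \<times> nat)) (facts s)"

lemma rec_fun_facts [rec_intros]: "rec_fun f \<Longrightarrow> rec_fun (\<lambda>x. facts (f x))"
proof (rule rec_fun_comp[where f = facts])
  show "rec_fun facts"
    by (rule rec_fun_primrec[where h = "\<lambda>s. apply_inst (fst (dec s :: rule_inst \<times> nat))"])
      (unfold apply_inst_def facts.simps, intro rec_intros, rule refl)
qed

lemma apply_rule_cases:
  "apply_rule t f g gs n xs ys y z D = D \<or> (\<exists>F. apply_rule t f g gs n xs ys y z D = add_fact F D)"
proof -
  \<comment> \<open>Nested conditionals with all leaves in \<open>S\<close> stay in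
    \<open>S\<close>, which replaces a case split over the rules.\<close>
  define S where "S = insert D (range (\<lambda>F. add_fact F D))"
  have "D \<in> S" "\<And>F. add_fact F D \<in> S" by (auto simp: S_def)
  moreover have "(if b then u else v) \<in> S" if "u \<in> S" "v \<in> S" for b u v using that by simp
  ultimately have "apply_rule t f g gs n xs ys y z D \<in> S" unfolding apply_rule_def by simp
  thus ?thesis unfolding S_def by blast
qed

lemma set_apply_rule: "set D \<subseteq> set (apply_rule t f g gs n xs ys y z D)"
  using apply_rule_cases[of t f g gs n xs ys y z D] by (auto simp: add_fact_def)

lemma facts_mono: "s \<le> s' \<Longrightarrow> set (facts s) \<subseteq> set (facts s')"
  by (rule lift_Suc_mono_le[of "\<lambda>s. set (facts s)"])
    (simp_all add: apply_inst_def set_apply_rule)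

text \<open>This holds for every number \<open>c\<close>, not just for codes, because
  \<open>add_fact\<close> refuses a second value. It is needed in this generality in
  \<open>locs_stabilise\<close>, where the index of the guessed reduction is arbitrary.\<close>

lemma facts_functional:
  "(c, xs, y) \<in> set (facts s) \<Longrightarrow> (c, xs, z) \<in> set (facts s') \<Longrightarrow> y = z"
proof -
  have invariant: "\<forall>c xs y z. (c, xs, y) \<in> set (facts s) \<longrightarrow> (c, xs, z) \<in> set (facts s) \<longrightarrow> y = z" for s
  proof (induction s)
    case (Suc s)
    have add: "(\<forall>c xs y z. (c, xs, y) \<in> set (add_fact F D) \<longrightarrow> (c, xs, z) \<in> set (add_fact F D) \<longrightarrow> y = z)"
      if "\<forall>c xs y z. (c, xs, y) \<in> set D \<longrightarrow> (c, xs, z) \<in> set D \<longrightarrow> y = z" for D F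
    proof (cases "\<exists>G\<in>set D. fst G = fst F \<and> fst (snd G) = fst (snd F)")
      case False
      show ?thesis
      proof (intro allI impI)
        fix c xs y z
        assume "(c, xs, y) \<in> set (add_fact F D)" "(c, xs, z) \<in> set (add_fact F D)"
        hence *: "(c, xs, y) \<in> set D \<or> F = (c, xs, y)" "(c, xs, z) \<in> set D \<or> F = (c, xs, z)"
          by (simp_all add: add_fact_def split: if_splits) blast+
        have "(c, xs, w) \<notin> set D" if "F = (c, xs, v)" for v w using False that by force
        with * \<open>\<forall>c xs y z. (c, xs, y) \<in> set D \<longrightarrow> (c, xs, z) \<in> set D \<longrightarrow> y = z\<close> show "y = z" 
          by (metis prod.inject)
      qed
    qed (use that in \<open>simp add: add_fact_def\<close>)
    have "facts (Suc s) = facts s \<or> (\<exists>F. facts (Suc s) = add_fact F (facts s))"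
      unfolding facts.simps apply_inst_def by (rule apply_rule_cases)
    thus ?case
    proof
      assume "facts (Suc s) = facts s"
      thus ?case using Suc by (simp only:)
    next
      assume "\<exists>F. facts (Suc s) = add_fact F (facts s)"
      then obtain F where "facts (Suc s) = add_fact F (facts s)" ..
      thus ?case using add[OF Suc, of F] by (simp only:)
    qed
  qed simp
  assume "(c, xs, y) \<in> set (facts s)" "(c, xs, z) \<in> set (facts s')"
  thus "y = z" using invariant[of "max s s'"] facts_mono[of s "max s s'"] facts_mono[of s' "max s s'"]
    by (meson max.cobounded1 max.cobounded2 subsetD)
qed

section \<open>Soundness and completeness of the enumeration\<close>

definition sound :: "fact list \<Rightarrow> bool" where
  "sound D \<longleftrightarrow> (\<forall>r xs y. (recf_enc r, xs, y) \<in> set D \<longrightarrow> evals r xs y)"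

lemma soundD: "sound D \<Longrightarrow> (recf_enc r, xs, y) \<in> set D \<Longrightarrow> evals r xs y"
  by (auto simp: sound_def)

lemma sound_add_fact:
  "sound D \<Longrightarrow> (\<And>r. recf_enc r = c \<Longrightarrow> evals r xs y) \<Longrightarrow> sound (add_fact (c, xs, y) D)"
  by (auto simp: sound_def add_fact_def)

lemma recf_enc_eq_simps:
  "recf_enc r = enc (0 :: nat, 0 :: nat) \<longleftrightarrow> r = Zero"
  "recf_enc r = enc (1 :: nat, 0 :: nat) \<longleftrightarrow> r = Succ"
  "recf_enc r = enc (2 :: nat, i) \<longleftrightarrow> r = Proj i"
  "recf_enc r = enc (3 :: nat, a, as) \<longleftrightarrow> (\<exists>f gs. r = Comp f gs \<and> recf_enc f = a \<and> map recf_enc gs = as)"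
  "recf_enc r = enc (4 :: nat, a, b) \<longleftrightarrow> (\<exists>f g. r = Prec f g \<and> recf_enc f = a \<and> recf_enc g = b)"
  "recf_enc r = enc (5 :: nat, a) \<longleftrightarrow> (\<exists>f. r = Mu f \<and> recf_enc f = a)"
  by (cases r; auto simp: enc_Pair_eq_iff simp del: enc_eq_iff; simp)+

lemma sound_apply_rule:
  assumes D: "sound D" shows "sound (apply_rule t f g gs n xs ys y z D)"
proof -
  note sD = soundD[OF D]
  have comp: "evals r xs z"
    if c: "length gs = length ys" "\<forall>i<length gs. (hd (drop i gs), xs, hd (drop i ys)) \<in> set D"
      "(f, ys, z) \<in> set D" and r: "recf_enc r = enc (3 :: nat, f, gs)" for r
  proof -
    obtain f' gs' where r': "r = Comp f' gs'" "recf_enc f' = f" "map recf_enc gs' = gs"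
      using r unfolding recf_enc_eq_simps by blast
    have "list_all2 (\<lambda>g y. evals g xs y) gs' ys"
      unfolding list_all2_conv_all_nth
    proof (intro conjI allI impI)
      show "length gs' = length ys" using c(1) r'(3) by auto
      fix i assume i: "i < length gs'"
      thus "evals (gs' ! i) xs (ys ! i)"
        using c(1,2) r'(3) by (intro sD) (auto simp: hd_drop_conv_nth)
    qed
    thus ?thesis using c(3) r' sD by (auto intro: evals_Comp)
  qed
  have mu: "evals r xs n"
    if c: "(f, n # xs, 0) \<in> set D" 
      "\<forall>i<n. \<exists>G\<in>set D. fst G = f \<and> fst (snd G) = i # xs \<and> snd (snd G) \<noteq> 0"
      and r: "recf_enc r = enc (5 :: nat, f)" for r
  proof -
    obtain f' where r': "r = Mu f'" "recf_enc f' = f"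
      using r unfolding recf_enc_eq_simps by blast
    have "\<exists>y. evals f' (i # xs) (Suc y)" if "i < n" for i
    proof -
      obtain G where G: "G \<in> set D" "fst G = f" "fst (snd G) = i # xs" "snd (snd G) \<noteq> 0"
        using c(2) \<open>i < n\<close> by blast
      then obtain y where "G = (f, i # xs, Suc y)" by (metis not0_implies_Suc prod.collapse)
      thus ?thesis using G(1) r'(2) sD by blast
    qed
    thus ?thesis using c(1) r' sD by (auto intro: evals_Mu)
  qed
  have ifI: "sound (if b then u else v)" if "b \<Longrightarrow> sound u" "\<not> b \<Longrightarrow> sound v" for b u v
    using that by simp
  show ?thesis unfolding apply_rule_def
  proof (intro ifI sound_add_fact D)
    fix r assume "n < length xs" "recf_enc r = enc (2 :: nat, n)"
    thus "evals r xs (hd (drop n xs))"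
      unfolding recf_enc_eq_simps by (simp add: hd_drop_conv_nth evals_Proj)
  next
    fix r assume "(f, xs, y) \<in> set D" "recf_enc r = enc (4 :: nat, f, g)"
    thus "evals r (0 # xs) y"
      unfolding recf_enc_eq_simps by (auto intro: evals_Prec_0 sD)
  next
    fix r assume *: "(enc (4 :: nat, f, g), n # xs, y) \<in> set D \<and> (g, n # y # xs, z) \<in> set D"
      and r: "recf_enc r = enc (4 :: nat, f, g)"
    obtain f' g' where r': "r = Prec f' g'" "recf_enc g' = g"
      using r unfolding recf_enc_eq_simps by blast
    have "evals r (n # xs) y" using * r sD by metis
    thus "evals r (Suc n # xs) z"
      using * r' sD by (auto intro: evals_Prec_Suc)
  qed (use comp mu in \<open>auto simp: recf_enc_eq_simps recf_enc_eq_simps(2)[unfolded One_nat_def] evals_Zero evals_Succ\<close>)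
qed

lemma sound_facts: "sound (facts s)"
  by (induction s) (simp add: sound_def, simp add: apply_inst_def sound_apply_rule)

text \<open>A refused fact is not lost: the value already recorded is correct by soundness, hence
  equal to \<open>y\<close> by determinism.\<close>

lemma add_fact_complete:
  assumes "sound D" "evals r xs y" shows "(recf_enc r, xs, y) \<in> set (add_fact (recf_enc r, xs, y) D)"
proof (cases "\<exists>G\<in>set D. fst G = recf_enc r \<and> fst (snd G) = xs")
  case True
  then obtain z where z: "(recf_enc r, xs, z) \<in> set D" by (metis prod.collapse)
  with assms have "z = y" using evals_det soundD by blast
  with z show ?thesis by (auto simp: add_fact_def)
qed (auto simp: add_fact_def)

lemma facts_complete_step:
  assumes "apply_inst p (facts s) = add_fact (recf_enc r, xs, y) (facts s)"
    "fst (dec s :: rule_inst \<times> nat) = p" "evals r xs y"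
  shows "\<exists>s. (recf_enc r, xs, y) \<in> set (facts s)"
  using add_fact_complete[OF sound_facts assms(3), of s] assms(1,2)
  by (intro exI[of _ "Suc s"]) simp

lemma uniform_stage:
  assumes "\<And>i. i < (n :: nat) \<Longrightarrow> \<exists>s. P i s" "\<And>i s s'. s \<le> (s' :: nat) \<Longrightarrow> P i s \<Longrightarrow> P i s'"
  shows "\<exists>s. \<forall>i<n. P i s"
  using assms(1)
proof (induction n)
  case (Suc n)
  obtain s where s: "\<forall>i<n. P i s" using Suc by auto
  obtain s' where s': "P n s'" using Suc.prems by blast
  have "P i (max s s')" if "i < Suc n" for i
  proof (cases "i = n")
    case True
    thus ?thesis using s' assms(2)[of s' "max s s'"] by simp
  next
    case False
    thus ?thesis using that s assms(2)[of s "max s s'"] by simp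
  qed
  thus ?case by blast
qed auto

text \<open>Induction on the computation: from some stage on all premises are listed, by
  monotonicity and finiteness, and the matching rule instance is scheduled later than that.\<close>

lemma facts_complete: "evals r xs y \<Longrightarrow> \<exists>s. (recf_enc r, xs, y) \<in> set (facts s)"
proof (induction rule: evals.induct)
  case (evals_Zero xs)
  obtain s where "fst (dec s :: rule_inst \<times> nat) = (0, 0, 0, [], 0, xs, [], 0, 0)"
    using dec_infinitely_often[of 0] .
  from facts_complete_step[OF _ this evals.evals_Zero] show ?case by (simp add: apply_rule_def)
next
  case (evals_Succ x)
  obtain s where "fst (dec s :: rule_inst \<times> nat) = (1, 0, 0, [], 0, [], [], x, 0)"
    using dec_infinitely_often[of 0] .
  from facts_complete_step[OF _ this evals.evals_Succ] show ?case by (simp add: apply_rule_def)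
next
  case (evals_Proj i xs)
  obtain s where "fst (dec s :: rule_inst \<times> nat) = (2, 0, 0, [], i, xs, [], 0, 0)"
    using dec_infinitely_often[of 0] .
  from facts_complete_step[OF _ this evals.evals_Proj[OF evals_Proj]] show ?case
    using evals_Proj by (simp add: apply_rule_def hd_drop_conv_nth)
next
  case (evals_Comp xs gs ys f z)
  have len: "length gs = length ys" and gs: "\<And>i. i < length gs \<Longrightarrow> evals (gs ! i) xs (ys ! i) \<and>
      (\<exists>s. (recf_enc (gs ! i), xs, ys ! i) \<in> set (facts s))"
    using evals_Comp.IH(1) by (auto simp: list_all2_conv_all_nth)
  have ev: "evals (Comp f gs) xs z"
    using gs len evals_Comp.hyps by (auto intro!: evals.evals_Comp simp: list_all2_conv_all_nth)
  obtain s1 where s1: "\<forall>i<length gs. (recf_enc (gs ! i), xs, ys ! i) \<in> set (facts s1)"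
    using uniform_stage[of "length gs" "\<lambda>i s. (recf_enc (gs ! i), xs, ys ! i) \<in> set (facts s)"]
      gs facts_mono by blast
  obtain s2 where s2: "(recf_enc f, ys, z) \<in> set (facts s2)" using evals_Comp.IH(2) by blast
  obtain s where s: "s \<ge> max s1 s2" "fst (dec s :: rule_inst \<times> nat)
      = (3, recf_enc f, 0, map recf_enc gs, 0, xs, ys, 0, z)"
    using dec_infinitely_often .
  have "\<forall>i<length gs. (recf_enc (gs ! i), xs, ys ! i) \<in> set (facts s)"
    "(recf_enc f, ys, z) \<in> set (facts s)"
    using s1 s2 s(1) facts_mono[of s1 s] facts_mono[of s2 s] by auto
  with facts_complete_step[OF _ s(2) ev] show ?case
    by (simp add: apply_rule_def hd_drop_conv_nth len)
next
  case (evals_Prec_0 f xs y g)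
  obtain s1 where s1: "(recf_enc f, xs, y) \<in> set (facts s1)" using evals_Prec_0.IH by blast
  obtain s where s: "s \<ge> s1" "fst (dec s :: rule_inst \<times> nat)
      = (4, recf_enc f, recf_enc g, [], 0, xs, [], y, 0)"
    using dec_infinitely_often .
  have "(recf_enc f, xs, y) \<in> set (facts s)" using s1 s(1) facts_mono[of s1 s] by auto
  with facts_complete_step[OF _ s(2) evals.evals_Prec_0[OF evals_Prec_0.hyps]] show ?case
    by (simp add: apply_rule_def)
next
  case (evals_Prec_Suc f g n xs y z)
  obtain s1 where s1: "(recf_enc (Prec f g), n # xs, y) \<in> set (facts s1)"
    using evals_Prec_Suc.IH by blast
  obtain s2 where s2: "(recf_enc g, n # y # xs, z) \<in> set (facts s2)"
    using evals_Prec_Suc.IH by blast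
  obtain s where s: "s \<ge> max s1 s2" "fst (dec s :: rule_inst \<times> nat)
      = (5, recf_enc f, recf_enc g, [], n, xs, [], y, z)"
    using dec_infinitely_often .
  have "(recf_enc (Prec f g), n # xs, y) \<in> set (facts s)" "(recf_enc g, n # y # xs, z) \<in> set (facts s)"
    using s1 s2 s(1) facts_mono[of s1 s] facts_mono[of s2 s] by auto
  with facts_complete_step[OF _ s(2) evals.evals_Prec_Suc[OF evals_Prec_Suc.hyps]] show ?case
    by (simp add: apply_rule_def)
next
  case (evals_Mu f n xs)
  obtain s1 where s1: "(recf_enc f, n # xs, 0) \<in> set (facts s1)" using evals_Mu.IH by blast
  have ev: "evals (Mu f) xs n" using evals_Mu by (blast intro: evals.evals_Mu)
  obtain s2 where s2: "\<forall>i<n. \<exists>y. (recf_enc f, i # xs, Suc y) \<in> set (facts s2)"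
    using uniform_stage[of n "\<lambda>i s. \<exists>y. (recf_enc f, i # xs, Suc y) \<in> set (facts s)"]
      evals_Mu.IH(2) facts_mono by blast
  obtain s where s: "s \<ge> max s1 s2" "fst (dec s :: rule_inst \<times> nat)
      = (6, recf_enc f, 0, [], n, xs, [], 0, 0)"
    using dec_infinitely_often .
  have "(recf_enc f, n # xs, 0) \<in> set (facts s)"
    using s1 s(1) facts_mono[of s1 s] by auto
  moreover have "\<exists>G\<in>set (facts s). fst G = recf_enc f \<and> fst (snd G) = i # xs \<and> snd (snd G) \<noteq> 0"
    if i: "i < n" for i
  proof -
    obtain y where "(recf_enc f, i # xs, Suc y) \<in> set (facts s2)" using s2 i by blast
    hence "(recf_enc f, i # xs, Suc y) \<in> set (facts s)" using s(1) facts_mono[of s2 s] by auto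
    thus ?thesis by (rule rev_bexI) simp
  qed
  ultimately have "(recf_enc f, n # xs, 0) \<in> set (facts s)" 
    "\<forall>i<n. \<exists>G\<in>set (facts s). fst G = recf_enc f \<and> fst (snd G) = i # xs \<and> snd (snd G) \<noteq> 0"
    by blast+
  with facts_complete_step[OF _ s(2) ev] show ?case
    by (simp add: apply_rule_def)
qed

lemma facts_iff: "evals r xs y \<longleftrightarrow> (\<exists>s. (recf_enc r, xs, y) \<in> set (facts s))"
  using facts_complete soundD[OF sound_facts] by blast

section \<open>The construction\<close>

lemma enc_le_enc_Pair: "enc a \<le> enc (a, b)" "enc b \<le> enc (a, b)"
  by (simp_all add: enc_prod_def le_prod_encode_1 le_prod_encode_2)

text \<open>A c.e. relation as an increasing union of uniformly decidable stages. A single stage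
  need not be an equivalence relation.\<close>

locale approximation =
  fixes E :: "nat rel" and P :: "nat \<Rightarrow> nat \<Rightarrow> nat \<Rightarrow> bool"
  assumes decidable: "decidable (\<lambda>p. P (fst p) (fst (snd p)) (snd (snd p)))"
    and mono: "P s x y \<Longrightarrow> s \<le> s' \<Longrightarrow> P s' x y"
    and iff: "(x, y) \<in> E \<longleftrightarrow> (\<exists>s. P s x y)"

lemma ce_rel_approximation:
  assumes "ce_rel E" obtains P where "approximation E P"
proof -
  obtain r where r: "\<And>x y. (x, y) \<in> E \<longleftrightarrow> (\<exists>z. evals r [x, y] z)"
    using assms unfolding ce_rel_def by blast
  define P where "P s x y \<longleftrightarrow> (\<exists>F\<in>set (facts s). fst F = recf_enc r \<and> fst (snd F) = [x, y])" for s x y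
  have "approximation E P"
  proof
    show "decidable (\<lambda>p. P (fst p) (fst (snd p)) (snd (snd p)))"
      unfolding P_def by (intro rec_intros)
    show "P s x y \<Longrightarrow> s \<le> s' \<Longrightarrow> P s' x y" for s x y s'
      unfolding P_def using facts_mono by blast
    show "(x, y) \<in> E \<longleftrightarrow> (\<exists>s. P s x y)" for x y
      unfolding r facts_iff P_def by force
  qed
  thus ?thesis by (rule that)
qed

text \<open>A function on all numbers that changes by finitely many merges is kept as a finite list,
  oldest merge first, so that the states of the construction have codes.\<close>

definition rep :: "(nat \<times> nat) list \<Rightarrow> nat \<Rightarrow> nat" where
  "rep h x = foldl (\<lambda>x p. if x = fst p then snd p else x) x h"

lemma rep_simps [simp]: "rep [] x = x"
  "rep (h @ [(a, b)]) x = (if rep h x = a then b else rep h x)"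
  by (simp_all add: rep_def)

definition locs :: "nat \<Rightarrow> (nat \<times> nat) list \<Rightarrow> nat list" where
  "locs n L = map snd (filter (\<lambda>p. fst p = n) L)"

lemma rec_fun_rep [rec_intros]:
  "rec_fun h \<Longrightarrow> rec_fun x \<Longrightarrow> rec_fun (\<lambda>y. rep (h y) (x y))"
  unfolding rep_def by (intro rec_intros)

lemma rec_fun_locs [rec_intros]:
  assumes "rec_fun n" "rec_fun L" shows "rec_fun (\<lambda>y. locs (n y) (L y))"
  unfolding locs_def by (intro rec_intros assms[THEN rec_fun_comp])

lemma set_locs: "x \<in> set (locs n L) \<longleftrightarrow> (n, x) \<in> set L"
  by (force simp: locs_def)

lemma locs_append: "locs n (L @ [(m, x)]) = (if m = n then locs n L @ [x] else locs n L)"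
  by (simp add: locs_def)

lemma locs_filter: "locs m (filter (\<lambda>p. fst p \<le> n) L) = (if m \<le> n then locs m L else [])"
proof -
  have "filter (\<lambda>p. fst p \<le> n \<and> fst p = m) L = (if m \<le> n then filter (\<lambda>p. fst p = m) L else [])"
    by (auto intro!: filter_cong simp: filter_empty_conv)
  thus ?thesis by (simp add: locs_def)
qed

text \<open>C.e. sets are presented as ranges of unary functions because they are used for the range
  of a reduction.\<close>

definition enumerates :: "nat \<Rightarrow> nat \<Rightarrow> nat \<Rightarrow> bool" where
  "enumerates e s y \<longleftrightarrow> (\<exists>F\<in>set (facts s). fst F = e \<and> length (fst (snd F)) = 1 \<and> snd (snd F) = y)"

lemma enumerates_mono: "enumerates e s y \<Longrightarrow> s \<le> s' \<Longrightarrow> enumerates e s' y"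
  unfolding enumerates_def using facts_mono by blast

lemma decidable_enumerates [rec_intros]:
  assumes "rec_fun e" "rec_fun s" "rec_fun y"
  shows "decidable (\<lambda>x. enumerates (e x) (s x) (y x))"
  unfolding enumerates_def by (intro rec_intros assms[THEN rec_fun_comp])

text \<open>A state consists of a list of substitutions, which composed send each number to its current
  representative, and of a list of pairs \<open>(n, x)\<close>: \<open>x\<close> is a coding location of the requirement
  that the \<open>n\<close>-th partial recursive function does not reduce \<open>E\<close> to \<open>R\<close>. In \<open>step\<close>, the kind \<open>k\<close>
  is 0 for copying \<open>A\<close>, 1 for coding \<open>V\<close>, 2 for making the c.e. set with index \<open>fst (dec n)\<close> meet
  the class of \<open>snd (dec n)\<close>, which cancels all locations of lower priority, and at least 3 for
  choosing a new location; \<open>2 * s + 1\<close> exceeds all odd numbers used before stage \<open>s\<close>.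
  List entries are written \<open>hd (drop i xs)\<close> since \<open>xs ! i\<close> is unspecified, hence not
  provably computable, for \<open>i\<close> out of range.\<close>

locale construction =
  A: approximation A As + R: approximation R Rs + V: approximation V Vs
  for A As R Rs V Vs +
  assumes equiv_A: "equiv UNIV A" and equiv_V: "equiv UNIV V"
begin

definition meets :: "nat \<Rightarrow> nat \<Rightarrow> (nat \<times> nat) list \<Rightarrow> bool" where
  "meets s n h \<longleftrightarrow> (\<exists>F\<in>set (facts s). fst F = fst (dec n :: nat \<times> nat) \<and> length (fst (snd F)) = 1
      \<and> rep h (snd (snd F)) = rep h (snd (dec n :: nat \<times> nat)))"

text \<open>Locations with index \<open>n\<close> itself also count as being of higher priority:
  coding for \<open>n\<close> comes before meeting for \<open>n\<close>, hence the comparison with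
  \<open>fst p \<le> n\<close>.\<close>

definition needs :: "nat \<Rightarrow> nat \<Rightarrow> nat \<Rightarrow> (nat \<times> nat) list \<Rightarrow> (nat \<times> nat) list \<Rightarrow> bool" where
  "needs s n i h L \<longleftrightarrow> enumerates (fst (dec n :: nat \<times> nat)) s i \<and> odd (rep h i)
     \<and> \<not> (\<exists>p\<in>set L. fst p \<le> n \<and> rep h (snd p) = rep h i) \<and> \<not> meets s n h"

text \<open>The test that function \<open>n\<close> still looks like a reduction on its locations.
  It compares \<open>V\<close> at positions, not \<open>E\<close> at locations, since the locations
  are meant to code \<open>V\<close>. The pairs with equal positions force convergence at every
  location, and an empty list passes the test.\<close>

definition agree :: "nat \<Rightarrow> nat \<Rightarrow> nat list \<Rightarrow> bool" where
  "agree s n xs \<longleftrightarrow> (\<forall>i<length xs. \<forall>j<length xs. \<exists>F\<in>set (facts s). \<exists>G\<in>set (facts s).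
     fst F = n \<and> fst (snd F) = [hd (drop i xs)] \<and> fst G = n \<and> fst (snd G) = [hd (drop j xs)] \<and>
     (Vs s i j \<longleftrightarrow> Rs s (snd (snd F)) (snd (snd G))))"

definition step :: "nat \<Rightarrow> nat \<Rightarrow> nat \<Rightarrow> nat \<Rightarrow> nat \<Rightarrow> (nat \<times> nat) list \<Rightarrow> (nat \<times> nat) list
    \<Rightarrow> (nat \<times> nat) list \<times> (nat \<times> nat) list" where
  "step s k n i j h L =
    (if k = 0 then
       (if As s i j then (h @ [(rep h (2 * i), rep h (2 * j))], L) else (h, L))
     else if k = 1 then
       (if i < length (locs n L) \<and> j < length (locs n L) \<and> Vs s i j
        then (h @ [(rep h (hd (drop i (locs n L))), rep h (hd (drop j (locs n L))))], L)
        else (h, L))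
     else if k = 2 then
       (if needs s n i h L
        then (h @ [(rep h i, rep h (snd (dec n :: nat \<times> nat)))], filter (\<lambda>p. fst p \<le> n) L)
        else (h, L))
     else (if agree s n (locs n L) then (h, L @ [(n, Suc (2 * s))]) else (h, L)))"

definition sched :: "nat \<Rightarrow> nat \<times> nat \<times> nat \<times> nat" where
  "sched s = fst (dec s :: (nat \<times> nat \<times> nat \<times> nat) \<times> nat)"

primrec state :: "nat \<Rightarrow> (nat \<times> nat) list \<times> (nat \<times> nat) list" where
  "state 0 = ([], [])"
| "state (Suc s) = step s (fst (sched s)) (fst (snd (sched s))) (fst (snd (snd (sched s))))
     (snd (snd (snd (sched s)))) (fst (state s)) (snd (state s))"

declare state.simps(2) [simp del]

abbreviation "rp s \<equiv> rep (fst (state s))"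
abbreviation "ls s \<equiv> snd (state s)"

definition E :: "nat rel" where
  "E = {(x, y). \<exists>s. rp s x = rp s y}"

lemma rec_fun_step [rec_intros]:
  assumes "rec_fun s" "rec_fun k" "rec_fun n" "rec_fun i" "rec_fun j" "rec_fun h" "rec_fun L"
  shows "rec_fun (\<lambda>x. step (s x) (k x) (n x) (i x) (j x) (h x) (L x))"
  unfolding step_def needs_def meets_def agree_def
  by (intro rec_intros assms[THEN rec_fun_comp] decidable_comp3[OF A.decidable]
    decidable_comp3[OF V.decidable] decidable_comp3[OF R.decidable])

lemma rec_fun_state [rec_intros]: "rec_fun f \<Longrightarrow> rec_fun (\<lambda>x. state (f x))"
proof (rule rec_fun_comp[where f = state])
  show "rec_fun state"
    by (rule rec_fun_primrec[where h = "\<lambda>s p. step s (fst (sched s)) (fst (snd (sched s)))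
        (fst (snd (snd (sched s)))) (snd (snd (snd (sched s)))) (fst p) (snd p)"])
      (unfold sched_def, intro rec_intros, unfold sched_def[symmetric], rule state.simps(2))
qed

lemma ce_rel_E: "ce_rel E"
  unfolding E_def by (rule ce_rel_Ex) (intro rec_intros)

lemma sched_infinitely_often:
  obtains s where "s \<ge> N" "sched s = a"
  using dec_infinitely_often[of N a] unfolding sched_def by blast

text \<open>The numbers named by an instruction are bounded by its stage, so they are smaller than
  the fresh locations \<open>2 * s + 1\<close> and beyond.\<close>

lemma sched_le:
  assumes "sched s = (k, n, i, j)" shows "n \<le> s" "i \<le> s"
proof -
  have "enc (dec s :: (nat \<times> nat \<times> nat \<times> nat) \<times> nat) = s" by simp
  moreover have "enc (k, n, i, j) \<le> enc (dec s :: (nat \<times> nat \<times> nat \<times> nat) \<times> nat)"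
    using enc_le_enc_Pair(1)[of "(k, n, i, j)" "snd (dec s :: (nat \<times> nat \<times> nat \<times> nat) \<times> nat)"] assms
    unfolding sched_def by (metis prod.collapse)
  ultimately have s: "enc (k, n, i, j) \<le> s" by simp
  show "n \<le> s" "i \<le> s"
    using s enc_le_enc_Pair(2)[of "(n, i, j)" k] enc_le_enc_Pair(1)[of n "(i, j)"]
      enc_le_enc_Pair(2)[of "(i, j)" n] enc_le_enc_Pair(1)[of i j]
    by simp_all
qed

section \<open>The effect of one stage and the invariant\<close>

definition acts :: "nat \<Rightarrow> nat \<Rightarrow> bool" where
  "acts n s \<longleftrightarrow> fst (sched s) = 2 \<and> fst (snd (sched s)) = n \<and>
     needs s n (fst (snd (snd (sched s)))) (fst (state s)) (ls s)"

definition merge :: "nat \<Rightarrow> nat \<Rightarrow> (nat \<Rightarrow> nat) \<Rightarrow> nat \<Rightarrow> nat" where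
  "merge a b f x = (if f x = a then b else f x)"

lemma rep_snoc: "rep (h @ [(a, b)]) = merge a b (rep h)"
  by (simp add: fun_eq_iff merge_def)

text \<open>Every stage performs at most one merge, or appends one location. Later inductions over
  stages refer to these five cases only, and no longer to the schedule or to
  \<open>step\<close>.\<close>

lemma state_cases:
  obtains (idle) "rp (Suc s) = rp s" "ls (Suc s) = ls s" "\<And>n. \<not> acts n s"
  | (A) i j where "(i, j) \<in> A" "rp (Suc s) = merge (rp s (2 * i)) (rp s (2 * j)) (rp s)"
      "ls (Suc s) = ls s" "\<And>n. \<not> acts n s"
  | (V) n i j where "i < length (locs n (ls s))" "j < length (locs n (ls s))" "(i, j) \<in> V"
      "rp (Suc s) = merge (rp s (locs n (ls s) ! i)) (rp s (locs n (ls s) ! j)) (rp s)"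
      "ls (Suc s) = ls s" "\<And>n. \<not> acts n s"
  | (S) n i where "acts n s" "\<And>m. acts m s \<Longrightarrow> m = n" "n \<le> s" "i \<le> s" "needs s n i (fst (state s)) (ls s)"
      "rp (Suc s) = merge (rp s i) (rp s (snd (dec n :: nat \<times> nat))) (rp s)"
      "ls (Suc s) = filter (\<lambda>p. fst p \<le> n) (ls s)"
  | (N) n where "agree s n (locs n (ls s))" "rp (Suc s) = rp s"
      "ls (Suc s) = ls s @ [(n, Suc (2 * s))]" "\<And>n. \<not> acts n s"
proof -
  obtain k n i j where sch: "sched s = (k, n, i, j)" by (cases "sched s") auto
  have st: "state (Suc s) = step s k n i j (fst (state s)) (ls s)" by (simp add: sch state.simps(2))
  have idle': thesis if "state (Suc s) = (fst (state s), ls s)" "\<And>n. \<not> acts n s"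
    using idle that by simp
  note bounds = sched_le[OF sch]
  consider "k = 0" | "k = 1" | "k = 2" | "k > 2" by linarith
  thus ?thesis
  proof cases
    case 1
    have na: "\<not> acts n s" for n using 1 by (simp add: acts_def sch)
    show ?thesis
    proof (cases "As s i j")
      case True
      hence "(i, j) \<in> A" using A.iff by blast
      thus ?thesis using A[of i j] st True 1 na by (simp add: step_def rep_snoc)
    qed (use idle' st 1 na in \<open>auto simp: step_def\<close>)
  next
    case 2
    have na: "\<not> acts n s" for n using 2 by (simp add: acts_def sch)
    show ?thesis
    proof (cases "i < length (locs n (ls s)) \<and> j < length (locs n (ls s)) \<and> Vs s i j")
      case True
      hence "(i, j) \<in> V" using V.iff by blast
      thus ?thesis using V[of i n j] st True 2 na by (simp add: step_def rep_snoc hd_drop_conv_nth)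
    qed (use idle' st 2 na in \<open>auto simp: step_def\<close>)
  next
    case 3
    show ?thesis
    proof (cases "needs s n i (fst (state s)) (ls s)")
      case True
      hence ac: "acts n s" using 3 by (simp add: acts_def sch)
      have uniq: "m = n" if "acts m s" for m using that by (simp add: acts_def sch)
      have "state (Suc s) = (fst (state s) @ [(rp s i, rp s (snd (dec n :: nat \<times> nat)))],
          filter (\<lambda>p. fst p \<le> n) (ls s))"
        using st True 3 by (simp add: step_def)
      thus ?thesis using S[OF ac uniq bounds True] by (simp only: rep_snoc fst_conv snd_conv)
    next
      case False
      hence "\<not> acts n s" for n by (auto simp: acts_def sch)
      thus ?thesis using idle' st False 3 by (simp add: step_def)
    qed
  next
    case 4
    have na: "\<not> acts n s" for n using 4 by (simp add: acts_def sch)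
    show ?thesis
    proof (cases "agree s n (locs n (ls s))")
      case True
      hence "state (Suc s) = (fst (state s), ls s @ [(n, Suc (2 * s))])" 
        using st 4 by (simp add: step_def)
      thus ?thesis using N[of n] True na by simp
    qed (use idle' st 4 na in \<open>auto simp: step_def\<close>)
  qed
qed

text \<open>The clause on \<open>Suc (2 * y)\<close> keeps future locations in singleton classes.
  Odd representatives keep locations away from the even numbers. The clauses concluding in
  \<open>V\<close> and \<open>A\<close> only say that no more than these relations is coded; the
  converses hold in the limit.\<close>

definition invariant :: "nat \<Rightarrow> (nat \<Rightarrow> nat) \<Rightarrow> (nat \<times> nat) list \<Rightarrow> bool" where
  "invariant s f L \<longleftrightarrow> (\<forall>x. f (f x) = f x) \<and> (\<forall>x. even x \<longrightarrow> even (f x)) \<and>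
     (\<forall>y\<ge>s. \<forall>x. f x = Suc (2 * y) \<longleftrightarrow> x = Suc (2 * y)) \<and>
     (\<forall>n x. (n, x) \<in> set L \<longrightarrow> odd (f x) \<and> x < Suc (2 * s)) \<and>
     (\<forall>m n x y. (m, x) \<in> set L \<longrightarrow> (n, y) \<in> set L \<longrightarrow> f x = f y \<longrightarrow> m = n) \<and>
     (\<forall>n i j. i < length (locs n L) \<longrightarrow> j < length (locs n L) \<longrightarrow>
        f (locs n L ! i) = f (locs n L ! j) \<longrightarrow> (i, j) \<in> V) \<and>
     (\<forall>u v. f (2 * u) = f (2 * v) \<longrightarrow> (u, v) \<in> A)"

lemma invariantD:
  assumes "invariant s f L"
  shows "f (f x) = f x" "even x \<Longrightarrow> even (f x)" "y \<ge> s \<Longrightarrow> f x = Suc (2 * y) \<longleftrightarrow> x = Suc (2 * y)"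
    "(n, x) \<in> set L \<Longrightarrow> odd (f x)" "(n, x) \<in> set L \<Longrightarrow> x < Suc (2 * s)"
    "(m, x) \<in> set L \<Longrightarrow> (n, y) \<in> set L \<Longrightarrow> f x = f y \<Longrightarrow> m = n"
    "i < length (locs n L) \<Longrightarrow> j < length (locs n L) \<Longrightarrow> f (locs n L ! i) = f (locs n L ! j) \<Longrightarrow> (i, j) \<in> V"
    "f (2 * u) = f (2 * v) \<Longrightarrow> (u, v) \<in> A"
  using assms unfolding invariant_def by blast+

lemma A_refl: "(x, x) \<in> A" and A_sym: "(x, y) \<in> A \<Longrightarrow> (y, x) \<in> A"
  and A_trans: "(x, y) \<in> A \<Longrightarrow> (y, z) \<in> A \<Longrightarrow> (x, z) \<in> A"
  using equiv_A by (auto elim!: equivE dest: refl_onD symD transD)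

lemma V_refl: "(x, x) \<in> V" and V_sym: "(x, y) \<in> V \<Longrightarrow> (y, x) \<in> V"
  and V_trans: "(x, y) \<in> V \<Longrightarrow> (y, z) \<in> V \<Longrightarrow> (x, z) \<in> V"
  using equiv_V by (auto elim!: equivE dest: refl_onD symD transD)

text \<open>The merged representatives are even and those of locations are odd, so no location
  moves. New identifications of even numbers follow from \<open>ij\<close> by symmetry and
  transitivity.\<close>

lemma invariant_merge_A:
  assumes I: "invariant s f L" and ij: "(i, j) \<in> A"
  shows "invariant (Suc s) (merge (f (2 * i)) (f (2 * j)) f) L"
proof -
  note D = invariantD[OF I]
  have ev: "even (f (2 * i))" "even (f (2 * j))" using D(2) by auto
  have L: "merge (f (2 * i)) (f (2 * j)) f x = f x" if "(n, x) \<in> set L" for n x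
    using D(4)[OF that] ev by (auto simp: merge_def)
  have locs: "merge (f (2 * i)) (f (2 * j)) f (locs n L ! l) = f (locs n L ! l)"
    if "l < length (locs n L)" for n l
    using L that by (metis nth_mem set_locs)
  show ?thesis unfolding invariant_def
  proof (intro conjI allI impI)
    show "merge (f (2 * i)) (f (2 * j)) f (merge (f (2 * i)) (f (2 * j)) f x)
      = merge (f (2 * i)) (f (2 * j)) f x" for x
      using D(1) by (simp add: merge_def)
    show "even (merge (f (2 * i)) (f (2 * j)) f x)" if "even x" for x
      using that ev D(2) by (simp add: merge_def)
    show "merge (f (2 * i)) (f (2 * j)) f x = Suc (2 * y) \<longleftrightarrow> x = Suc (2 * y)" if "y \<ge> Suc s" for x y
    proof -
      have "f (2 * i) \<noteq> Suc (2 * y)" "f (2 * j) \<noteq> Suc (2 * y)"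
        using ev by (metis even_Suc even_mult_iff even_numeral)+
      thus ?thesis using D(3)[of y x] that by (auto simp: merge_def)
    qed
    show "odd (merge (f (2 * i)) (f (2 * j)) f x)" if "(n, x) \<in> set L" for n x
      using that D(4) L by simp
    show "x < Suc (2 * Suc s)" if "(n, x) \<in> set L" for n x
      using D(5)[OF that] by simp
    show "m = n" if "(m, x) \<in> set L" "(n, y) \<in> set L" 
      "merge (f (2 * i)) (f (2 * j)) f x = merge (f (2 * i)) (f (2 * j)) f y" for m n x y
      using that D(6) L by metis
    show "(k, l) \<in> V" if "k < length (locs n L)" "l < length (locs n L)" 
      "merge (f (2 * i)) (f (2 * j)) f (locs n L ! k) = merge (f (2 * i)) (f (2 * j)) f (locs n L ! l)" for n k l
      using that D(7) locs by metis
    show "(u, v) \<in> A" if "merge (f (2 * i)) (f (2 * j)) f (2 * u) = merge (f (2 * i)) (f (2 * j)) f (2 * v)" for u v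
      using that D(8) ij A_sym A_trans unfolding merge_def by (metis (full_types))
  qed
qed

text \<open>Both representatives are odd and belong to locations of \<open>n\<close>, so even
  numbers and the locations of other requirements do not move.\<close>

lemma invariant_merge_V:
  assumes I: "invariant s f L" and k: "k < length (locs n L)" and l: "l < length (locs n L)" and kl: "(k, l) \<in> V"
  shows "invariant (Suc s) (merge (f (locs n L ! k)) (f (locs n L ! l)) f) L"
proof -
  note D = invariantD[OF I]
  define a b where "a = f (locs n L ! k)" and "b = f (locs n L ! l)"
  have mem: "(n, locs n L ! k) \<in> set L" "(n, locs n L ! l) \<in> set L"
    using k l nth_mem set_locs by metis+
  have od: "odd a" "odd b" using D(4) mem by (auto simp: a_def b_def)
  have fresh: "a \<noteq> Suc (2 * y)" "b \<noteq> Suc (2 * y)" if "y \<ge> s" for y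
    using D(3)[OF that] D(5)[OF mem(1)] D(5)[OF mem(2)] that by (auto simp: a_def b_def)
  have same: "m = n" if "(m, x) \<in> set L" "f x = a \<or> f x = b" for m x
    using that D(6) mem by (auto simp: a_def b_def)
  have ff: "f a = a" "f b = b" using D(1) by (auto simp: a_def b_def)
  have ev: "merge a b f x = f x" if "even x" for x
    using od D(2)[OF that] by (auto simp: merge_def)
  have "invariant (Suc s) (merge a b f) L" unfolding invariant_def
  proof (intro conjI allI impI)
    show "merge a b f (merge a b f x) = merge a b f x" for x
      using D(1) ff by (simp add: merge_def)
    show "even (merge a b f x)" if "even x" for x
      using that ev D(2) by simp
    show "merge a b f x = Suc (2 * y) \<longleftrightarrow> x = Suc (2 * y)" if "y \<ge> Suc s" for x y
      using that fresh[of y] D(3)[of y x] by (auto simp: merge_def)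
    show "odd (merge a b f x)" if "(n, x) \<in> set L" for n x
      using that D(4) od by (simp add: merge_def)
    show "x < Suc (2 * Suc s)" if "(n, x) \<in> set L" for n x
      using D(5)[OF that] by simp
    show "m = m'" if "(m, x) \<in> set L" "(m', y) \<in> set L" "merge a b f x = merge a b f y" for m m' x y
      using that D(6) same unfolding merge_def by (metis (full_types))
    show "(u, v) \<in> V" if uv: "u < length (locs m L)" "v < length (locs m L)" 
      "merge a b f (locs m L ! u) = merge a b f (locs m L ! v)" for m u v
    proof (cases "m = n")
      case True
      have a: "(w, k) \<in> V" if "w < length (locs n L)" "f (locs n L ! w) = a" for w
        using D(7)[OF that(1) k] that(2) by (simp add: a_def)
      have b: "(w, l) \<in> V" if "w < length (locs n L)" "f (locs n L ! w) = b" for w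
        using D(7)[OF that(1) l] that(2) by (simp add: b_def)
      show ?thesis using uv a[of u] a[of v] b[of u] b[of v] D(7)[of u n v] kl V_sym V_trans
        unfolding merge_def True by (metis (full_types))
    next
      case False
      hence "f (locs m L ! w) \<noteq> a" if "w < length (locs m L)" for w
        using same that nth_mem set_locs by metis
      thus ?thesis using uv D(7) by (simp add: merge_def)
    qed
    show "(u, v) \<in> A" if "merge a b f (2 * u) = merge a b f (2 * v)" for u v
      using that D(8) ev by simp
  qed
  thus ?thesis by (simp add: a_def b_def)
qed

text \<open>The class that moves contains no even number and, by \<open>free\<close>, no surviving
  location. Hence it does not matter whether the target is equivalent to an even number or to a
  surviving location.\<close>

lemma invariant_merge_S:
  assumes I: "invariant s f L" and od: "odd (f i)" and i: "i \<le> s" and t: "t \<le> s"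
    and free: "\<And>m x. (m, x) \<in> set L \<Longrightarrow> m \<le> n \<Longrightarrow> f x \<noteq> f i"
  shows "invariant (Suc s) (merge (f i) (f t) f) (filter (\<lambda>p. fst p \<le> n) L)"
proof -
  note D = invariantD[OF I]
  define a b where "a = f i" and "b = f t"
  have fresh: "a \<noteq> Suc (2 * y)" "b \<noteq> Suc (2 * y)" if "y \<ge> s" for y
    using D(3)[OF that] i t that by (auto simp: a_def b_def)
  have ff: "f a = a" "f b = b" using D(1) by (auto simp: a_def b_def)
  have ev: "merge a b f x = f x" if "even x" for x
    using od D(2)[OF that] by (auto simp: merge_def a_def)
  have L: "merge a b f x = f x" if "(m, x) \<in> set L" "m \<le> n" for m x
    using free[OF that] by (simp add: merge_def a_def)
  let ?L = "filter (\<lambda>p. fst p \<le> n) L"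
  have "invariant (Suc s) (merge a b f) ?L" unfolding invariant_def
  proof (intro conjI allI impI)
    show "merge a b f (merge a b f x) = merge a b f x" for x
      using D(1) ff by (simp add: merge_def)
    show "even (merge a b f x)" if "even x" for x
      using that ev D(2) by simp
    show "merge a b f x = Suc (2 * y) \<longleftrightarrow> x = Suc (2 * y)" if "y \<ge> Suc s" for x y
      using that fresh[of y] D(3)[of y x] by (auto simp: merge_def)
    show "odd (merge a b f x)" if "(m, x) \<in> set ?L" for m x
      using that D(4) L by auto
    show "x < Suc (2 * Suc s)" if "(m, x) \<in> set ?L" for m x
      using D(5)[of m x] that by simp
    show "m = m'" if "(m, x) \<in> set ?L" "(m', y) \<in> set ?L" "merge a b f x = merge a b f y" for m m' x y
      using that D(6)[of m x m' y] L[of m x] L[of m' y] by simp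
    show "(u, v) \<in> V" if uv: "u < length (locs m ?L)" "v < length (locs m ?L)" 
      "merge a b f (locs m ?L ! u) = merge a b f (locs m ?L ! v)" for m u v
    proof (cases "m \<le> n")
      case True
      have "merge a b f (locs m L ! w) = f (locs m L ! w)" if "w < length (locs m L)" for w
        using L[OF _ True] that nth_mem set_locs by metis
      thus ?thesis using uv D(7) True by (simp add: locs_filter)
    qed (use uv in \<open>simp add: locs_filter\<close>)
    show "(u, v) \<in> A" if "merge a b f (2 * u) = merge a b f (2 * v)" for u v
      using that D(8) ev by simp
  qed
  thus ?thesis by (simp add: a_def b_def)
qed

text \<open>By freshness the new location is its own representative and is equivalent to no older
  location, so only the trivial pair of positions has to be in \<open>V\<close>.\<close>

lemma invariant_append:
  assumes I: "invariant s f L" shows "invariant (Suc s) f (L @ [(n, Suc (2 * s))])"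
proof -
  note D = invariantD[OF I]
  have f: "f (Suc (2 * s)) = Suc (2 * s)" using D(3)[of s] by simp
  have new: "f x \<noteq> Suc (2 * s)" if "(m, x) \<in> set L" for m x
    using D(3)[of s x] D(5)[OF that] by auto
  have new': "f (locs m L ! k) \<noteq> Suc (2 * s)" if "k < length (locs m L)" for m k
    using new that nth_mem set_locs by metis
  show ?thesis unfolding invariant_def
  proof (intro conjI allI impI)
    show "f x = Suc (2 * y) \<longleftrightarrow> x = Suc (2 * y)" if "y \<ge> Suc s" for x y
      using D(3)[of y x] that by simp
    show "odd (f x)" if "(m, x) \<in> set (L @ [(n, Suc (2 * s))])" for m x
      using that D(4) f by auto
    show "x < Suc (2 * Suc s)" if "(m, x) \<in> set (L @ [(n, Suc (2 * s))])" for m x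
      using that D(5)[of m x] by auto
    show "m = m'" if "(m, x) \<in> set (L @ [(n, Suc (2 * s))])" "(m', y) \<in> set (L @ [(n, Suc (2 * s))])" 
      "f x = f y" for m m' x y
      using that D(6)[of m x m' y] new[of m x] new[of m' y] f by auto
    show "(u, v) \<in> V" if uv: "u < length (locs m (L @ [(n, Suc (2 * s))]))" "v < length (locs m (L @ [(n, Suc (2 * s))]))" 
      "f (locs m (L @ [(n, Suc (2 * s))]) ! u) = f (locs m (L @ [(n, Suc (2 * s))]) ! v)" for m u v
      using uv D(7)[of u m v] new'[of u m] new'[of v m] f V_refl
      by (auto simp: locs_append nth_append less_Suc_eq split: if_splits)
  qed (use D in auto)
qed

lemma invariant_state: "invariant s (rp s) (ls s)"
proof (induction s)
  case 0
  show ?case using A_refl by (simp add: invariant_def locs_def)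
next
  case (Suc s)
  have mono: "invariant (Suc s) f L" if I: "invariant s f L" for f L
    unfolding invariant_def
  proof (intro conjI allI impI)
    show "x < Suc (2 * Suc s)" if "(n, x) \<in> set L" for n x
      using invariantD(5)[OF I that] by simp
    show "f x = Suc (2 * y) \<longleftrightarrow> x = Suc (2 * y)" if "y \<ge> Suc s" for x y
      using invariantD(3)[OF I, of y x] that by simp
    show "(i, j) \<in> V" if "i < length (locs n L)" "j < length (locs n L)"
      "f (locs n L ! i) = f (locs n L ! j)" for n i j
      using that by (rule invariantD(7)[OF I])
    show "(u, v) \<in> A" if "f (2 * u) = f (2 * v)" for u v
      using that by (rule invariantD(8)[OF I])
  qed (erule invariantD[OF I] | rule invariantD(1)[OF I] | (rule invariantD(6)[OF I]; assumption))+
  show ?case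
  proof (cases rule: state_cases[of s])
    case idle
    thus ?thesis using mono[OF Suc] by simp
  next
    case (A i j)
    thus ?thesis using invariant_merge_A[OF Suc] by simp
  next
    case (V n i j)
    thus ?thesis using invariant_merge_V[OF Suc] by simp
  next
    case (S n i)
    have "snd (dec n :: nat \<times> nat) \<le> n"
      using enc_le_enc_Pair(2)[of "snd (dec n :: nat \<times> nat)" "fst (dec n :: nat \<times> nat)"] by simp
    hence "snd (dec n :: nat \<times> nat) \<le> s" using S(3) by simp
    moreover have "odd (rp s i)" "\<And>m x. (m, x) \<in> set (ls s) \<Longrightarrow> m \<le> n \<Longrightarrow> rp s x \<noteq> rp s i"
      using S(5) by (auto simp: needs_def)
    ultimately have "invariant (Suc s) (merge (rp s i) (rp s (snd (dec n :: nat \<times> nat))) (rp s))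
        (filter (\<lambda>p. fst p \<le> n) (ls s))"
      using S(4) by (intro invariant_merge_S[OF Suc])
    thus ?thesis by (simp only: S(6,7))
  next
    case (N n)
    thus ?thesis using invariant_append[OF Suc] by simp
  qed
qed

end

lemma uniform_eventually:
  fixes n :: nat
  assumes "\<And>i. i < n \<Longrightarrow> \<exists>b. \<forall>s\<ge>b. P i s"
  shows "\<exists>b :: nat. \<forall>s\<ge>b. \<forall>i<n. P i s"
proof -
  have "\<exists>b. \<forall>i<n. \<forall>s\<ge>b. P i s"
  proof (rule uniform_stage[where P = "\<lambda>i b. \<forall>s\<ge>b. P i s"])
    show "\<exists>b. \<forall>s\<ge>b. P i s" if "i < n" for i using assms[OF that] .
  qed auto
  thus ?thesis by blast
qed

context construction
begin

section \<open>The constructed relation and the finiteness of injuries\<close>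

lemma rp_Suc_eq: "rp s x = rp s y \<Longrightarrow> rp (Suc s) x = rp (Suc s) y"
proof -
  have "rp (Suc s) = rp s \<or> (\<exists>a b. rp (Suc s) = merge a b (rp s))"
    by (cases rule: state_cases[of s]) blast+
  thus "rp s x = rp s y \<Longrightarrow> rp (Suc s) x = rp (Suc s) y" by (auto simp: merge_def)
qed

lemma rp_eq_mono:
  assumes "rp s x = rp s y" "s \<le> s'" shows "rp s' x = rp s' y"
  using assms(2) by (induction s' rule: dec_induct) (fact assms(1), rule rp_Suc_eq)

lemma even_rp_mono: "even (rp s x) \<Longrightarrow> s \<le> s' \<Longrightarrow> even (rp s' x)"
  using rp_eq_mono[of s "rp s x" x s'] invariantD(1)[OF invariant_state, of s x] invariantD(2)[OF invariant_state, of "rp s x" s']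
  by simp

lemma equiv_E: "equiv UNIV E"
proof (rule equivI)
  show "refl E" by (auto simp: refl_on_def E_def)
  show "sym E" by (auto simp: sym_def E_def dest: sym)
  show "trans E"
  proof (rule transI)
    fix x y z assume "(x, y) \<in> E" "(y, z) \<in> E"
    then obtain s s' where "rp s x = rp s y" "rp s' y = rp s' z" by (auto simp: E_def)
    hence "rp (max s s') x = rp (max s s') z" using rp_eq_mono by (metis max.cobounded1 max.cobounded2)
    thus "(x, z) \<in> E" by (auto simp: E_def)
  qed
qed auto

lemma E_sym: "(x, y) \<in> E \<Longrightarrow> (y, x) \<in> E"
  using equiv_E by (auto elim!: equivE dest: symD)

lemma E_late: "(x, y) \<in> E \<Longrightarrow> \<exists>b. \<forall>s\<ge>b. rp s x = rp s y"
  unfolding E_def using rp_eq_mono by blast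

lemma ceer_E: "ceer E"
  using equiv_E ce_rel_E by (simp add: ceer_def)

text \<open>The invariant prevents extra identifications. Conversely, once \<open>As\<close> shows
  the pair, the copying instruction for it is scheduled at a later stage.\<close>

lemma E_double_iff: "(2 * u, 2 * v) \<in> E \<longleftrightarrow> (u, v) \<in> A"
proof
  assume "(2 * u, 2 * v) \<in> E"
  thus "(u, v) \<in> A" using invariantD(8)[OF invariant_state] by (auto simp: E_def)
next
  assume "(u, v) \<in> A"
  then obtain s0 where s0: "As s0 u v" using A.iff by blast
  obtain s where s: "s \<ge> s0" "sched s = (0, 0, u, v)" by (rule sched_infinitely_often)
  have "As s u v" using A.mono s0 s(1) .
  hence "rp (Suc s) (2 * u) = rp (Suc s) (2 * v)"
    using s(2) by (simp add: state.simps(2) step_def)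
  thus "(2 * u, 2 * v) \<in> E" by (auto simp: E_def)
qed

lemma meets_mono:
  assumes "meets s n (fst (state s))" "s \<le> s'" shows "meets s' n (fst (state s'))"
proof -
  obtain F where F: "F \<in> set (facts s)" "fst F = fst (dec n :: nat \<times> nat)" "length (fst (snd F)) = 1"
    "rp s (snd (snd F)) = rp s (snd (dec n :: nat \<times> nat))"
    using assms(1) unfolding meets_def by blast
  show ?thesis unfolding meets_def
    using F facts_mono[OF assms(2)] rp_eq_mono[OF F(4) assms(2)] by blast
qed

lemma acts_merges:
  assumes "acts n s"
  shows "rp (Suc s) (fst (snd (snd (sched s)))) = rp (Suc s) (snd (dec n :: nat \<times> nat))"
  using assms by (simp add: acts_def state.simps(2) step_def)

lemma acts_meets:
  assumes "acts n s" shows "meets (Suc s) n (fst (state (Suc s)))"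
proof -
  let ?i = "fst (snd (snd (sched s)))"
  have "enumerates (fst (dec n :: nat \<times> nat)) (Suc s) ?i"
    using assms enumerates_mono[of _ s _ "Suc s"] by (auto simp: acts_def needs_def)
  then obtain F where "F \<in> set (facts (Suc s))" "fst F = fst (dec n :: nat \<times> nat)"
    "length (fst (snd F)) = 1" "snd (snd F) = ?i"
    unfolding enumerates_def by blast
  with acts_merges[OF assms] show ?thesis unfolding meets_def by (intro bexI[of _ F]) simp_all
qed

text \<open>After acting, the c.e. set meets its target class. This persists, and
  \<open>needs\<close> excludes it. Each requirement therefore acts at most once, which makes the
  injuries finite.\<close>

lemma acts_once: "acts n s \<Longrightarrow> s < s' \<Longrightarrow> \<not> acts n s'"
  using acts_meets meets_mono[of "Suc s" n s'] by (auto simp: acts_def needs_def)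

lemma acts_finite: "\<exists>s0. \<forall>s\<ge>s0. \<forall>m<n. \<not> acts m s"
proof -
  have "\<exists>s0. \<forall>s\<ge>s0. \<not> acts m s" for m
  proof (cases "\<exists>s. acts m s")
    case True
    then obtain s where "acts m s" ..
    hence "\<forall>s'\<ge>Suc s. \<not> acts m s'" using acts_once Suc_le_eq by blast
    thus ?thesis ..
  qed blast
  thus ?thesis by (rule uniform_eventually)
qed

section \<open>Stabilisation of the coding locations\<close>

definition quiet :: "nat \<Rightarrow> nat \<Rightarrow> bool" where
  "quiet n s0 \<longleftrightarrow> (\<forall>s\<ge>s0. \<forall>m<n. \<not> acts m s)"

text \<open>Only an action of index below \<open>n\<close> cancels locations of \<open>n\<close>, so
  after such actions have ceased the list can only grow, and each growth witnesses
  agreement.\<close>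

lemma locs_Suc:
  assumes "quiet n s0" "s0 \<le> s"
  shows "locs n (ls (Suc s)) = locs n (ls s) \<or>
    locs n (ls (Suc s)) = locs n (ls s) @ [Suc (2 * s)] \<and> agree s n (locs n (ls s))"
proof (cases rule: state_cases[of s])
  case (S m i)
  hence "n \<le> m" using assms unfolding quiet_def by (metis not_le)
  thus ?thesis by (simp add: S(7) locs_filter)
next
  case (N m)
  thus ?thesis by (auto simp: locs_append)
qed simp_all

lemma locs_mono:
  assumes "quiet n s0" "s0 \<le> s" "s \<le> s'"
  shows "\<exists>zs. locs n (ls s') = locs n (ls s) @ zs"
  using assms(3)
proof (induction s' rule: dec_induct)
  case (step s')
  thus ?case using locs_Suc[OF assms(1), of s'] assms(2) by fastforce
qed auto

lemma locs_nth_eq: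
  assumes "quiet n s0" "s0 \<le> s" "s0 \<le> s'" "i < length (locs n (ls s))" "i < length (locs n (ls s'))"
  shows "locs n (ls s) ! i = locs n (ls s') ! i"
  using locs_mono[OF assms(1,2), of s'] locs_mono[OF assms(1,3), of s] assms(4,5)
  by (metis linear nth_append)

text \<open>If the list kept changing, it would grow to an infinite sequence of permanent locations
  with agreement at arbitrarily late stages. Sending \<open>i\<close> to the value of function
  \<open>n\<close> at the \<open>i\<close>-th location would then reduce \<open>V\<close> to
  \<open>R\<close>.\<close>

lemma locs_stabilise:
  assumes "\<not> V \<le>\<^sub>c R"
  shows "\<exists>s1. \<forall>s\<ge>s1. locs n (ls s) = locs n (ls s1)"
proof (rule ccontr)
  assume unstable: "\<not> ?thesis"
  obtain s0 where q: "quiet n s0" unfolding quiet_def using acts_finite by blast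
  have grow: "\<exists>s\<ge>b. locs n (ls (Suc s)) = locs n (ls s) @ [Suc (2 * s)] \<and> agree s n (locs n (ls s))"
    if b: "b \<ge> s0" for b
  proof (rule ccontr)
    assume *: "\<not> ?thesis"
    have "locs n (ls s) = locs n (ls b)" if "s \<ge> b" for s
      using that
    proof (induction s rule: dec_induct)
      case (step s)
      have "locs n (ls (Suc s)) = locs n (ls s)"
        using * locs_Suc[OF q, of s] b step.hyps(1) by (meson le_trans)
      thus ?case using step.IH by simp
    qed simp
    with unstable show False by blast
  qed
  have long: "\<exists>s\<ge>s0. N < length (locs n (ls s))" for N
  proof (induction N)
    case 0
    obtain s where "s \<ge> s0" "locs n (ls (Suc s)) = locs n (ls s) @ [Suc (2 * s)]" using grow by blast
    thus ?case by (intro exI[of _ "Suc s"]) simp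
  next
    case (Suc N)
    then obtain s where s: "s \<ge> s0" "N < length (locs n (ls s))" by blast
    obtain s' where s': "s' \<ge> s" "locs n (ls (Suc s')) = locs n (ls s') @ [Suc (2 * s')]"
      using grow[OF s(1)] by blast
    have "length (locs n (ls s)) \<le> length (locs n (ls s'))"
      using locs_mono[OF q s(1) s'(1)] by auto
    thus ?case using s s' by (intro exI[of _ "Suc s'"]) simp
  qed
  have late: "\<exists>s\<ge>b. s \<ge> s0 \<and> N < length (locs n (ls s)) \<and> agree s n (locs n (ls s))" for N b
  proof -
    obtain s where s: "s \<ge> s0" "N < length (locs n (ls s))" using long by blast
    obtain s' where s': "s' \<ge> max s b" "agree s' n (locs n (ls s'))"
      using grow[of "max s b"] s(1) by (auto simp: le_max_iff_disj)
    have "length (locs n (ls s)) \<le> length (locs n (ls s'))"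
      using locs_mono[OF q s(1), of s'] s'(1) by auto
    thus ?thesis using s s' by (intro exI[of _ s']) auto
  qed
  \<comment> \<open>A witness is a stage after \<open>s0\<close> together with the value found by
    then at the \<open>i\<close>-th location; searching for it gives the reduction
    \<open>f\<close>.\<close>
  define P where "P i w \<longleftrightarrow> s0 \<le> fst w \<and> i < length (locs n (ls (fst w))) \<and>
    (n, [hd (drop i (locs n (ls (fst w))))], snd w) \<in> set (facts (fst w))" for i and w :: "nat \<times> nat"
  have "decidable (\<lambda>p. P (fst p) (snd p))" unfolding P_def by (intro rec_intros)
  moreover have "\<exists>w. P i w" for i
  proof -
    obtain s where s: "s \<ge> s0" "i < length (locs n (ls s))" "agree s n (locs n (ls s))"
      using late[of 0 i] by blast
    then obtain F where "F \<in> set (facts s)" "fst F = n" "fst (snd F) = [hd (drop i (locs n (ls s)))]"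
      unfolding agree_def by blast
    hence "(n, [hd (drop i (locs n (ls s)))], snd (snd F)) \<in> set (facts s)"
      by (metis prod.collapse)
    hence "P i (s, snd (snd F))" using s by (simp add: P_def)
    thus ?thesis ..
  qed
  ultimately obtain g where g: "rec_fun g" "\<And>i. P i (g i)" using rec_search[of P] by blast
  define f where "f i = snd (g i)" for i
  \<comment> \<open>The value does not depend on the stage: after \<open>s0\<close> the
    \<open>i\<close>-th location is permanent, and the enumerated functions are
    single-valued.\<close>
  have val: "y = f i" if "s \<ge> s0" "i < length (locs n (ls s))"
    "(n, [hd (drop i (locs n (ls s)))], y) \<in> set (facts s)" for i s y
  proof -
    have "locs n (ls s) ! i = locs n (ls (fst (g i))) ! i"
      using locs_nth_eq[OF q that(1) _ that(2)] g(2)[of i] by (auto simp: P_def)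
    thus ?thesis using that g(2)[of i] facts_functional
      by (auto simp: P_def f_def hd_drop_conv_nth)
  qed
  \<comment> \<open>Agreement at arbitrarily late stages suffices: a pair that has entered one of
    the two approximations stays there, so it enters the other as well.\<close>
  have agr: "\<exists>s\<ge>b. Vs s i j \<longleftrightarrow> Rs s (f i) (f j)" for b i j
  proof -
    obtain s where s: "s \<ge> b" "s \<ge> s0" "max i j < length (locs n (ls s))" "agree s n (locs n (ls s))"
      using late by blast
    then obtain F G where FG: "F \<in> set (facts s)" "fst F = n" "fst (snd F) = [hd (drop i (locs n (ls s)))]"
      "G \<in> set (facts s)" "fst G = n" "fst (snd G) = [hd (drop j (locs n (ls s)))]"
      "Vs s i j \<longleftrightarrow> Rs s (snd (snd F)) (snd (snd G))"
      using s(3) s(4)[unfolded agree_def, rule_format, of i j] by auto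
    have "(n, [hd (drop i (locs n (ls s)))], snd (snd F)) \<in> set (facts s)"
      "(n, [hd (drop j (locs n (ls s)))], snd (snd G)) \<in> set (facts s)"
      using FG by (metis prod.collapse)+
    hence "snd (snd F) = f i" "snd (snd G) = f j"
      using s(2,3) by (auto intro!: val)
    thus ?thesis using FG(7) s(1) by auto
  qed
  have "(i, j) \<in> V \<longleftrightarrow> (f i, f j) \<in> R" for i j
  proof
    assume "(i, j) \<in> V"
    then obtain b where b: "Vs b i j" using V.iff by blast
    obtain s where "s \<ge> b" "Vs s i j \<longleftrightarrow> Rs s (f i) (f j)" using agr by blast
    thus "(f i, f j) \<in> R" using V.mono[OF b] R.iff by blast
  next
    assume "(f i, f j) \<in> R"
    then obtain b where b: "Rs b (f i) (f j)" using R.iff by blast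
    obtain s where "s \<ge> b" "Vs s i j \<longleftrightarrow> Rs s (f i) (f j)" using agr by blast
    thus "(i, j) \<in> V" using R.mono[OF b] V.iff by blast
  qed
  moreover have "computable f"
    unfolding rec_fun_nat[symmetric] f_def by (intro rec_intros g(1))
  ultimately have "V \<le>\<^sub>c R" unfolding reducible_def reduces_via_def by blast
  with assms show False ..
qed

definition limit :: "nat \<Rightarrow> nat list \<Rightarrow> bool" where
  "limit n xs \<longleftrightarrow> (\<exists>b. \<forall>s\<ge>b. locs n (ls s) = xs)"

lemma limit_exists: "\<not> V \<le>\<^sub>c R \<Longrightarrow> \<exists>xs. limit n xs"
  using locs_stabilise unfolding limit_def by blast

text \<open>The invariant gives one direction. For the other, the instruction to code the pair is
  scheduled after the list has become final and \<open>Vs\<close> shows the pair.\<close>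

lemma limit_V_iff:
  assumes "limit n xs" "i < length xs" "j < length xs"
  shows "(xs ! i, xs ! j) \<in> E \<longleftrightarrow> (i, j) \<in> V"
proof
  obtain b where b: "\<And>s. s \<ge> b \<Longrightarrow> locs n (ls s) = xs" using assms(1) unfolding limit_def by blast
  {
    assume "(xs ! i, xs ! j) \<in> E"
    then obtain c where c: "\<forall>s\<ge>c. rp s (xs ! i) = rp s (xs ! j)" using E_late by blast
    show "(i, j) \<in> V"
      using invariantD(7)[OF invariant_state[of "max b c"], of i n j] b[of "max b c"] c assms(2,3) by simp
  next
    assume "(i, j) \<in> V"
    then obtain s0 where s0: "Vs s0 i j" using V.iff by blast
    obtain s where s: "s \<ge> max b s0" "sched s = (1, n, i, j)" by (rule sched_infinitely_often)
    have "Vs s i j" using V.mono s0 s(1) by simp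
    hence "rp (Suc s) (xs ! i) = rp (Suc s) (xs ! j)"
      using s b[of s] assms(2,3) by (simp add: state.simps(2) step_def hd_drop_conv_nth)
    thus "(xs ! i, xs ! j) \<in> E" by (auto simp: E_def)
  }
qed

text \<open>An even representative would stay even until a stage at which \<open>x\<close> is a
  location, contrary to the invariant.\<close>

lemma limit_odd:
  assumes "limit n xs" "x \<in> set xs" shows "odd (rp s x)"
proof -
  obtain b where b: "\<And>s. s \<ge> b \<Longrightarrow> locs n (ls s) = xs" using assms(1) unfolding limit_def by blast
  have "(n, x) \<in> set (ls (max b s))" using assms(2) b[of "max b s"] set_locs by (metis max.cobounded1)
  hence "odd (rp (max b s) x)" by (rule invariantD(4)[OF invariant_state])
  thus ?thesis using even_rp_mono[of s x "max b s"] by auto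
qed

lemma limit_unique:
  assumes "limit m xs" "limit n ys" "x \<in> set xs" "y \<in> set ys" "(x, y) \<in> E" shows "m = n"
proof -
  obtain b where b: "\<And>s. s \<ge> b \<Longrightarrow> locs m (ls s) = xs" using assms(1) unfolding limit_def by blast
  obtain c where c: "\<And>s. s \<ge> c \<Longrightarrow> locs n (ls s) = ys" using assms(2) unfolding limit_def by blast
  obtain d where d: "\<And>s. s \<ge> d \<Longrightarrow> rp s x = rp s y" using E_late[OF assms(5)] by blast
  define s where "s = max b (max c d)"
  have "b \<le> s" "c \<le> s" "d \<le> s" by (auto simp: s_def)
  hence "(m, x) \<in> set (ls s)" "(n, y) \<in> set (ls s)" "rp s x = rp s y"
    using assms(3,4) b c d by (simp_all flip: set_locs)
  thus ?thesis by (rule invariantD(6)[OF invariant_state])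
qed

text \<open>Permanent agreement would make a later stage of kind 3 append to a list that is already
  final.\<close>

lemma limit_not_agree:
  assumes "limit n xs" "\<And>s. s \<ge> c \<Longrightarrow> agree s n xs" shows False
proof -
  obtain b where b: "\<And>s. s \<ge> b \<Longrightarrow> locs n (ls s) = xs" using assms(1) unfolding limit_def by blast
  obtain s where s: "s \<ge> max b c" "sched s = (3, n, 0, 0)" by (rule sched_infinitely_often)
  have "locs n (ls (Suc s)) = xs @ [Suc (2 * s)]"
    using s b[of s] assms(2)[of s] by (simp add: state.simps(2) step_def locs_append)
  thus False using b[of "Suc s"] s(1) by simp
qed

text \<open>The empty list agrees vacuously, so a first location is always supplied.\<close>

lemma limit_nonempty: "limit n xs \<Longrightarrow> xs \<noteq> []"
  using limit_not_agree[of n "[]" 0] by (auto simp: agree_def)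

section \<open>Satisfaction of both kinds of requirements\<close>

lemma settles:
  assumes "approximation Q Qs" shows "\<exists>b. \<forall>s\<ge>b. Qs s x y \<longleftrightarrow> (x, y) \<in> Q"
  using approximation.iff[OF assms, of x y] approximation.mono[OF assms] by blast

text \<open>On the final list \<open>E\<close> codes \<open>V\<close>, so a reduction
  \<open>f\<close> of \<open>E\<close> to \<open>R\<close> makes \<open>V\<close> at the positions
  match \<open>R\<close> at the values. The list is finite: the values of \<open>f\<close> there are
  eventually enumerated and both approximations settle, so agreement becomes permanent, which is
  impossible.\<close>

lemma not_E_reducible_R:
  assumes "\<not> V \<le>\<^sub>c R" shows "\<not> E \<le>\<^sub>c R"
proof
  assume "E \<le>\<^sub>c R"
  then obtain f r where r: "\<And>x. evals r [x] (f x)" and f: "\<And>x y. (x, y) \<in> E \<longleftrightarrow> (f x, f y) \<in> R"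
    unfolding reducible_def reduces_via_def computable_def by blast
  define n where "n = recf_enc r"
  obtain xs where xs: "limit n xs" using locs_stabilise[OF assms] unfolding limit_def by blast
  have "\<exists>s. (n, [xs ! i], f (xs ! i)) \<in> set (facts s)" for i
    using r facts_iff unfolding n_def by blast
  then obtain a where a: "\<forall>i<length xs. (n, [xs ! i], f (xs ! i)) \<in> set (facts a)"
    using uniform_stage[of "length xs" "\<lambda>i s. (n, [xs ! i], f (xs ! i)) \<in> set (facts s)"] facts_mono by blast
  have "\<exists>b. \<forall>s\<ge>b. (Vs s i j \<longleftrightarrow> (i, j) \<in> V) \<and> (Rs s (f (xs ! i)) (f (xs ! j)) \<longleftrightarrow> (f (xs ! i), f (xs ! j)) \<in> R)"
    (is "\<exists>b. \<forall>s\<ge>b. ?P i j s") for i j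
  proof -
    obtain b where "\<forall>s\<ge>b. Vs s i j \<longleftrightarrow> (i, j) \<in> V" 
      using settles[OF V.approximation_axioms] by blast
    moreover obtain b' where
      "\<forall>s\<ge>b'. Rs s (f (xs ! i)) (f (xs ! j)) \<longleftrightarrow> (f (xs ! i), f (xs ! j)) \<in> R"
      using settles[OF R.approximation_axioms] by blast
    ultimately have "\<forall>s\<ge>max b b'. ?P i j s" by simp
    thus ?thesis ..
  qed
  hence "\<exists>b. \<forall>s\<ge>b. \<forall>j<length xs. ?P i j s" for i
    by (rule uniform_eventually)
  hence "\<exists>b. \<forall>s\<ge>b. \<forall>i<length xs. \<forall>j<length xs. ?P i j s"
    by (rule uniform_eventually)
  then obtain b where b: "\<And>i j s. i < length xs \<Longrightarrow> j < length xs \<Longrightarrow> s \<ge> b \<Longrightarrow> ?P i j s" by blast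
  have "agree s n xs" if s: "s \<ge> max a b" for s
    unfolding agree_def
  proof (intro allI impI)
    fix i j assume ij: "i < length xs" "j < length xs"
    have "(i, j) \<in> V \<longleftrightarrow> (f (xs ! i), f (xs ! j)) \<in> R"
      using limit_V_iff[OF xs ij] f by blast
    hence V: "Vs s i j \<longleftrightarrow> Rs s (f (xs ! i)) (f (xs ! j))" using b[OF ij, of s] s by simp
    have mem: "(n, [xs ! k], f (xs ! k)) \<in> set (facts s)" if "k < length xs" for k
      using a facts_mono[of a s] s that by auto
    show "\<exists>F\<in>set (facts s). \<exists>G\<in>set (facts s). fst F = n \<and> fst (snd F) = [hd (drop i xs)] \<and> fst G = n \<and>
        fst (snd G) = [hd (drop j xs)] \<and> (Vs s i j \<longleftrightarrow> Rs s (snd (snd F)) (snd (snd G)))"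
      by (rule bexI[OF bexI[OF _ mem[OF ij(2)]] mem[OF ij(1)]]) (simp add: V ij hd_drop_conv_nth)
  qed
  from limit_not_agree[OF xs this] show False .
qed

text \<open>\<open>Q\<close> collects the final locations of all indices up to \<open>n\<close>, the
  code of the pair \<open>(e, t)\<close>. An enumerated element equivalent to no even number and to
  no member of \<open>Q\<close> would be a legitimate candidate at a late stage, and the action
  there would merge it with \<open>t\<close>.\<close>

lemma enumerates_meets_or_bounded:
  assumes VR: "\<not> V \<le>\<^sub>c R"
    and none: "\<And>y s. enumerates e s y \<Longrightarrow> (y, t) \<notin> E"
  shows "\<exists>Q. finite Q \<and> (\<forall>x s. enumerates e s x \<longrightarrow> (\<exists>u. (x, 2 * u) \<in> E) \<or> (\<exists>q\<in>Q. (x, q) \<in> E))"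
proof -
  define n where "n = enc (e, t)"
  have n: "dec n = (e, t)" by (simp add: n_def)
  obtain X where X: "\<And>m. limit m (X m)"
    using limit_exists[OF VR] by metis
  have "\<exists>b. \<forall>s\<ge>b. \<forall>m<Suc n. locs m (ls s) = X m"
    using X by (intro uniform_eventually) (auto simp: limit_def)
  then obtain b where b: "\<And>m s. m \<le> n \<Longrightarrow> s \<ge> b \<Longrightarrow> locs m (ls s) = X m" by (auto simp: less_Suc_eq_le)
  define Q where "Q = (\<Union>m\<le>n. set (X m))"
  have "(\<exists>u. (x, 2 * u) \<in> E) \<or> (\<exists>q\<in>Q. (x, q) \<in> E)" if x: "enumerates e c x" for x c
  proof (rule ccontr)
    assume neg: "\<not> ?thesis"
    have odd: "odd (rp s x)" for s
    proof
      assume "even (rp s x)"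
      then obtain u where "rp s x = 2 * u" by blast
      hence "rp s x = rp s (2 * u)" using invariantD(1)[OF invariant_state, of s x] by simp
      hence "(x, 2 * u) \<in> E" by (auto simp: E_def)
      with neg show False by blast
    qed
    obtain s where s: "s \<ge> max b c" "sched s = (2, n, x, 0)" by (rule sched_infinitely_often)
    have "enumerates e s x" using enumerates_mono[OF x] s(1) by simp
    moreover have "rp s (snd p) \<noteq> rp s x" if "p \<in> set (ls s)" "fst p \<le> n" for p
    proof
      assume "rp s (snd p) = rp s x"
      hence "(x, snd p) \<in> E" unfolding E_def by (simp add: exI[of _ s])
      moreover have "snd p \<in> set (X (fst p))" 
        using b[OF that(2), of s] s(1) that(1) set_locs[of "snd p" "fst p" "ls s"] by simp
      ultimately show False using neg that(2) unfolding Q_def by blast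
    qed
    moreover have "\<not> meets s n (fst (state s))"
    proof
      assume "meets s n (fst (state s))"
      then obtain F where "F \<in> set (facts s)" "fst F = e" "length (fst (snd F)) = 1"
        "rp s (snd (snd F)) = rp s t"
        unfolding meets_def n by auto
      hence "enumerates e s (snd (snd F))" "(snd (snd F), t) \<in> E"
        unfolding enumerates_def E_def by blast+
      thus False using none by blast
    qed
    ultimately have "acts n s" using odd s(2) by (auto simp: acts_def needs_def n)
    hence "rp (Suc s) x = rp (Suc s) t" using acts_merges s(2) n by fastforce
    hence "(x, t) \<in> E" by (auto simp: E_def)
    thus False using none x by blast
  qed
  thus ?thesis by (intro exI[of _ Q]) (auto simp: Q_def)
qed

lemma enumerates_range:
  assumes "\<And>x. evals r [x] (f x)"
  shows "(\<exists>s. enumerates (recf_enc r) s y) \<longleftrightarrow> y \<in> range f"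
proof
  assume "\<exists>s. enumerates (recf_enc r) s y"
  then obtain s F where "F \<in> set (facts s)" "fst F = recf_enc r" "length (fst (snd F)) = 1" "snd (snd F) = y"
    unfolding enumerates_def by blast
  moreover from this obtain x where "fst (snd F) = [x]" by (auto simp: length_Suc_conv)
  ultimately have "(recf_enc r, [x], y) \<in> set (facts s)" by (metis prod.collapse)
  hence "evals r [x] y" using facts_iff by blast
  thus "y \<in> range f" using evals_det assms by blast
next
  assume "y \<in> range f"
  then obtain x s where "(recf_enc r, [x], y) \<in> set (facts s)" using assms facts_iff by blast
  thus "\<exists>s. enumerates (recf_enc r) s y" unfolding enumerates_def by force
qed

end

lemma strong_minimal_cover_construction:
  assumes "ceer A" "ceer R" "ceer V" "\<not> V \<le>\<^sub>c R"
  obtains E and g :: "nat \<Rightarrow> nat" where "ceer E" "\<And>u v. (2 * u, 2 * v) \<in> E \<longleftrightarrow> (u, v) \<in> A"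
    "\<And>i j. (g i, g j) \<in> E \<longleftrightarrow> i = j" "\<And>i u. (g i, 2 * u) \<notin> E"
    "\<And>f. computable f \<Longrightarrow> (\<forall>y. \<exists>x. (f x, y) \<in> E) \<or>
       (\<exists>Q. finite Q \<and> (\<forall>x. (\<exists>u. (f x, 2 * u) \<in> E) \<or> (\<exists>q\<in>Q. (f x, q) \<in> E)))"
    "\<not> E \<le>\<^sub>c R"
proof -
  obtain As where As: "approximation A As" using assms(1) ce_rel_approximation unfolding ceer_def by blast
  obtain Rs where Rs: "approximation R Rs" using assms(2) ce_rel_approximation unfolding ceer_def by blast
  obtain Vs where Vs: "approximation V Vs" using assms(3) ce_rel_approximation unfolding ceer_def by blast
  interpret construction A As R Rs V Vs
    using As Rs Vs assms(1,3) by (auto simp: construction_def construction_axioms_def ceer_def)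
  obtain X where X: "\<And>m. limit m (X m)"
    using limit_exists[OF assms(4)] by metis
  have hd: "hd (X m) \<in> set (X m)" for m using limit_nonempty[OF X] by simp
  show ?thesis
  \<comment> \<open>The first final location of each requirement represents a class without even
    numbers, and different requirements give different classes.\<close>
  proof (rule that[of E "\<lambda>m. hd (X m)"])
    show "ceer E" by (rule ceer_E)
    show "(2 * u, 2 * v) \<in> E \<longleftrightarrow> (u, v) \<in> A" for u v by (rule E_double_iff)
    show "(hd (X i), hd (X j)) \<in> E \<longleftrightarrow> i = j" for i j
      using limit_unique[OF X X hd hd] by (auto simp: E_def)
    show "(hd (X i), 2 * u) \<notin> E" for i u
    proof
      assume "(hd (X i), 2 * u) \<in> E"
      then obtain s where "rp s (hd (X i)) = rp s (2 * u)" by (auto simp: E_def)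
      moreover have "even (rp s (2 * u))" using invariantD(2)[OF invariant_state] by simp
      ultimately show False using limit_odd[OF X hd, of s i] by simp
    qed
    show "\<not> E \<le>\<^sub>c R" by (rule not_E_reducible_R[OF assms(4)])
    show "(\<forall>y. \<exists>x. (f x, y) \<in> E) \<or>
       (\<exists>Q. finite Q \<and> (\<forall>x. (\<exists>u. (f x, 2 * u) \<in> E) \<or> (\<exists>q\<in>Q. (f x, q) \<in> E)))" if f: "computable f" for f
    proof (cases "\<forall>y. \<exists>x. (f x, y) \<in> E")
      case False
      then obtain t where t: "\<And>x. (f x, t) \<notin> E" by blast
      obtain r where r: "\<And>x. evals r [x] (f x)" using f unfolding computable_def by blast
      have range: "enumerates (recf_enc r) s y \<Longrightarrow> y \<in> range f"
        and ex: "\<exists>s. enumerates (recf_enc r) s (f x)" for s x y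
        using enumerates_range[of r f, OF r] by blast+
      have "(y, t) \<notin> E" if "enumerates (recf_enc r) s y" for y s
        using range[OF that] t by auto
      hence "\<exists>Q. finite Q \<and> (\<forall>x s. enumerates (recf_enc r) s x \<longrightarrow>
          (\<exists>u. (x, 2 * u) \<in> E) \<or> (\<exists>q\<in>Q. (x, q) \<in> E))"
        by (rule enumerates_meets_or_bounded[OF assms(4)])
      then obtain Q where Q: "finite Q" and bd: "\<forall>x s. enumerates (recf_enc r) s x \<longrightarrow>
          (\<exists>u. (x, 2 * u) \<in> E) \<or> (\<exists>q\<in>Q. (x, q) \<in> E)" by (elim exE conjE)
      have "(\<exists>u. (f x, 2 * u) \<in> E) \<or> (\<exists>q\<in>Q. (f x, q) \<in> E)" for x
      proof -
        obtain s where "enumerates (recf_enc r) s (f x)" using ex ..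
        with bd show ?thesis by (elim allE) (erule (1) mp)
      qed
      with Q show ?thesis by (intro disjI2 exI[of _ Q]) simp
    qed simp
  qed
qed

section \<open>Minimal covers\<close>

lemma reducible_trans: "X \<le>\<^sub>c Y \<Longrightarrow> Y \<le>\<^sub>c Z \<Longrightarrow> X \<le>\<^sub>c Z"
proof -
  assume "X \<le>\<^sub>c Y" "Y \<le>\<^sub>c Z"
  then obtain f g where fg: "rec_fun f" "\<And>x y. (x, y) \<in> X \<longleftrightarrow> (f x, f y) \<in> Y"
    "rec_fun g" "\<And>x y. (x, y) \<in> Y \<longleftrightarrow> (g x, g y) \<in> Z"
    unfolding reducible_def reduces_via_def rec_fun_nat[symmetric] by blast
  thus "X \<le>\<^sub>c Z" unfolding reducible_def reduces_via_def rec_fun_nat[symmetric]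
    using rec_fun_comp[OF fg(3,1)] by (intro exI[of _ "\<lambda>x. g (f x)"]) simp
qed

lemma reducibleI: "rec_fun f \<Longrightarrow> (\<And>x y. (x, y) \<in> X \<longleftrightarrow> (f x, f y) \<in> Y) \<Longrightarrow> X \<le>\<^sub>c Y"
  unfolding reducible_def reduces_via_def rec_fun_nat by blast

lemma reducibleE:
  assumes "X \<le>\<^sub>c Y"
  obtains f where "rec_fun f" "\<And>x y. (x, y) \<in> X \<longleftrightarrow> (f x, f y) \<in> Y"
  using assms unfolding reducible_def reduces_via_def rec_fun_nat by blast

lemma uniform_join_iff:
  "(x, y) \<in> E \<oplus>\<^sub>c R \<longleftrightarrow>
    (if even x then even y \<and> (x div 2, y div 2) \<in> E else odd y \<and> (x div 2, y div 2) \<in> R)"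
proof (cases "even x"; cases "even y")
  assume "even x" "even y"
  then obtain u v where "x = 2 * u" "y = 2 * v" by blast
  thus ?thesis by (auto simp: uniform_join_def) presburger
next
  assume "even x" "odd y"
  then obtain u v where "x = 2 * u" "y = 2 * v + 1" by (blast elim: oddE)
  thus ?thesis by (auto simp: uniform_join_def) presburger+
next
  assume "odd x" "even y"
  then obtain u v where "x = 2 * u + 1" "y = 2 * v" by (blast elim: oddE)
  thus ?thesis by (auto simp: uniform_join_def) presburger+
next
  assume "odd x" "odd y"
  then obtain u v where "x = 2 * u + 1" "y = 2 * v + 1" by (blast elim: oddE)
  thus ?thesis by (auto simp: uniform_join_def) presburger
qed

lemma Id_mod_iff: "(x, y) \<in> Id_mod n \<longleftrightarrow> x mod n = y mod n"
  by (simp add: Id_mod_def cong_def)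

lemma ceer_Id_mod: "ceer (Id_mod n)"
proof -
  have "ce_rel {(x, y). \<exists>w :: nat. x mod n = y mod n}" by (rule ce_rel_Ex) (intro rec_intros)
  moreover have "{(x, y). \<exists>w :: nat. x mod n = y mod n} = Id_mod n" by (auto simp: Id_mod_iff)
  moreover have "equiv UNIV (Id_mod n)"
    by (auto intro!: equivI simp: refl_on_def sym_def trans_def Id_mod_iff)
  ultimately show ?thesis by (simp add: ceer_def)
qed

lemma ceer_refl: "ceer E \<Longrightarrow> (x, x) \<in> E"
  and ceer_sym: "ceer E \<Longrightarrow> (x, y) \<in> E \<Longrightarrow> (y, x) \<in> E"
  and ceer_trans: "ceer E \<Longrightarrow> (x, y) \<in> E \<Longrightarrow> (y, z) \<in> E \<Longrightarrow> (x, z) \<in> E"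
  unfolding ceer_def by (auto elim!: equivE dest: refl_onD symD transD)

lemma ceer_uniform_join:
  assumes "ceer E" "ceer R" shows "ceer (E \<oplus>\<^sub>c R)"
proof -
  obtain Es where Es: "approximation E Es" using assms(1) ce_rel_approximation unfolding ceer_def by blast
  obtain Rs where Rs: "approximation R Rs" using assms(2) ce_rel_approximation unfolding ceer_def by blast
  define P where "P s x y \<longleftrightarrow> (if even x then even y \<and> Es s (x div 2) (y div 2)
    else odd y \<and> Rs s (x div 2) (y div 2))" for s x y
  have "ce_rel {(x, y). \<exists>s. P s x y}"
    unfolding P_def by (intro ce_rel_Ex rec_intros decidable_comp3[OF approximation.decidable[OF Es]]
        decidable_comp3[OF approximation.decidable[OF Rs]])
  moreover have "{(x, y). \<exists>s. P s x y} = E \<oplus>\<^sub>c R"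
    by (auto simp: P_def uniform_join_iff approximation.iff[OF Es] approximation.iff[OF Rs] split: if_splits)
  moreover have "equiv UNIV (E \<oplus>\<^sub>c R)"
    using assms by (intro equivI refl_onI symI transI)
      (auto simp: uniform_join_iff intro: ceer_refl ceer_sym ceer_trans split: if_splits)
  ultimately show ?thesis by (simp add: ceer_def)
qed

lemma reducible_join_left: "E \<le>\<^sub>c E \<oplus>\<^sub>c R"
  by (rule reducibleI[where f = "\<lambda>x. 2 * x"]) (intro rec_intros, simp add: uniform_join_iff)

lemma reducible_join_right: "R \<le>\<^sub>c E \<oplus>\<^sub>c R"
  by (rule reducibleI[where f = "\<lambda>x. Suc (2 * x)"]) (intro rec_intros, simp add: uniform_join_iff)

text \<open>The outcome of the construction as far as it does not involve \<open>R\<close>. The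
  function \<open>g\<close> lists representatives of infinitely many classes without even numbers;
  it is not assumed to be computable.\<close>

locale minimal_cover =
  fixes A E :: "nat rel" and g :: "nat \<Rightarrow> nat"
  assumes ceer_E: "ceer E"
    and double: "(2 * u, 2 * v) \<in> E \<longleftrightarrow> (u, v) \<in> A"
    and g_inj: "(g i, g j) \<in> E \<longleftrightarrow> i = j"
    and g_new: "(g i, 2 * u) \<notin> E"
    and range: "computable f \<Longrightarrow> (\<forall>y. \<exists>x. (f x, y) \<in> E) \<or>
       (\<exists>Q. finite Q \<and> (\<forall>x. (\<exists>u. (f x, 2 * u) \<in> E) \<or> (\<exists>q\<in>Q. (f x, q) \<in> E)))"
begin

section \<open>The range dichotomy and reductions to the cover\<close>

lemmas E_refl = ceer_refl[OF ceer_E] and E_sym = ceer_sym[OF ceer_E] and E_trans = ceer_trans[OF ceer_E]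

lemma A_reducible: "A \<le>\<^sub>c E"
  by (rule reducibleI[where f = "\<lambda>x. 2 * x"]) (intro rec_intros, simp add: double)

text \<open>Even numbers stay fixed and odd ones go to \<open>n\<close> of the new classes. These
  are read from a finite list because only finitely many values of \<open>g\<close> may be used as
  constants.\<close>

lemma join_Id_reducible:
  assumes "n \<ge> 1" shows "A \<oplus>\<^sub>c Id_mod n \<le>\<^sub>c E"
proof (rule reducibleI[where f = "\<lambda>x. if even x then x else hd (drop (x div 2 mod n) (map g [0..<n]))"])
  show "rec_fun (\<lambda>x. if even x then x else hd (drop (x div 2 mod n) (map g [0..<n])))"
    by (intro rec_intros)
  have hd: "hd (drop (x mod n) (map g [0..<n])) = g (x mod n)" for x
    using assms by (simp add: hd_drop_conv_nth)
  show "(x, y) \<in> A \<oplus>\<^sub>c Id_mod n \<longleftrightarrow> 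
    (if even x then x else hd (drop (x div 2 mod n) (map g [0..<n])),
     if even y then y else hd (drop (y div 2 mod n) (map g [0..<n]))) \<in> E" for x y
    unfolding hd uniform_join_iff Id_mod_iff
    using double[of "x div 2" "y div 2"] g_inj g_new[of "y div 2 mod n" "x div 2"]
      g_new[of "x div 2 mod n" "y div 2"] E_sym[of x "g (y div 2 mod n)"]
    by (cases "even x"; cases "even y") (simp_all, blast)
qed

text \<open>Thinning out \<open>Q\<close> to inequivalent members that are equivalent to no even
  number makes the position in the list determine the class. The choice is not effective, but its
  result is finite data.\<close>

lemma finite_representatives:
  assumes "finite Q"
  shows "\<exists>qs. (\<forall>i<length qs. \<forall>j<length qs. (qs ! i, qs ! j) \<in> E \<longrightarrow> i = j) \<and>
    (\<forall>i<length qs. \<forall>u. (qs ! i, 2 * u) \<notin> E) \<and>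
    (\<forall>q\<in>Q. (\<exists>u. (q, 2 * u) \<in> E) \<or> (\<exists>i<length qs. (q, qs ! i) \<in> E))"
  using assms
proof (induction Q rule: finite_induct)
  case empty
  show ?case by (intro exI[of _ "[]"]) simp
next
  case (insert q Q)
  then obtain qs where qs: "\<forall>i<length qs. \<forall>j<length qs. (qs ! i, qs ! j) \<in> E \<longrightarrow> i = j"
    "\<forall>i<length qs. \<forall>u. (qs ! i, 2 * u) \<notin> E"
    "\<forall>q\<in>Q. (\<exists>u. (q, 2 * u) \<in> E) \<or> (\<exists>i<length qs. (q, qs ! i) \<in> E)" by blast
  show ?case
  proof (cases "(\<exists>u. (q, 2 * u) \<in> E) \<or> (\<exists>i<length qs. (q, qs ! i) \<in> E)")
    case True
    thus ?thesis using qs by (intro exI[of _ qs]) simp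
  next
    case False
    show ?thesis
    proof (intro exI[of _ "qs @ [q]"] conjI allI impI ballI)
      show "i = j" if "i < length (qs @ [q])" "j < length (qs @ [q])" 
        "((qs @ [q]) ! i, (qs @ [q]) ! j) \<in> E" for i j
      proof -
        have "(q, qs ! k) \<notin> E" "(qs ! k, q) \<notin> E" if "k < length qs" for k
          using that False E_sym by blast+
        thus ?thesis using that qs(1) by (auto simp: nth_append less_Suc_eq split: if_splits)
      qed
      show "((qs @ [q]) ! i, 2 * u) \<notin> E" if "i < length (qs @ [q])" for i u
        using that False qs(2) by (auto simp: nth_append less_Suc_eq)
      show "(\<exists>u. (p, 2 * u) \<in> E) \<or> (\<exists>i<length (qs @ [q]). (p, (qs @ [q]) ! i) \<in> E)" 
        if p: "p \<in> insert q Q" for p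
      proof (cases "p = q")
        case True
        thus ?thesis using E_refl by (intro disjI2 exI[of _ "length qs"]) simp
      next
        case False
        with p qs(3) consider "\<exists>u. (p, 2 * u) \<in> E" | i where "i < length qs" "(p, qs ! i) \<in> E" by blast
        thus ?thesis
        proof cases
          case 2
          thus ?thesis by (intro disjI2 exI[of _ i]) (simp add: nth_append)
        qed simp
      qed
    qed
  qed
qed

text \<open>If the range of \<open>f\<close> misses a class, each \<open>f x\<close> is equivalent
  to an even number or to an entry of a finite list. Searching for such a partner computes an
  element of \<open>A \<oplus>\<^sub>c Id_mod k\<close>.\<close>

lemma reduction_dichotomy:
  assumes "reduces_via f X E"
  shows "(\<forall>y. \<exists>x. (f x, y) \<in> E) \<or> (\<exists>k\<ge>1. X \<le>\<^sub>c A \<oplus>\<^sub>c Id_mod k)"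
proof (cases "\<forall>y. \<exists>x. (f x, y) \<in> E")
  case False
  have f: "rec_fun f" "\<And>x y. (x, y) \<in> X \<longleftrightarrow> (f x, f y) \<in> E"
    using assms by (auto simp: reduces_via_def rec_fun_nat)
  obtain Q where Q: "finite Q" "\<And>x. (\<exists>u. (f x, 2 * u) \<in> E) \<or> (\<exists>q\<in>Q. (f x, q) \<in> E)"
    using range[of f] f(1) False by (auto simp: rec_fun_nat)
  obtain qs where qs: "\<And>i j. i < length qs \<Longrightarrow> j < length qs \<Longrightarrow> (qs ! i, qs ! j) \<in> E \<Longrightarrow> i = j"
    "\<And>i u. i < length qs \<Longrightarrow> (qs ! i, 2 * u) \<notin> E"
    "\<And>q. q \<in> Q \<Longrightarrow> (\<exists>u. (q, 2 * u) \<in> E) \<or> (\<exists>i<length qs. (q, qs ! i) \<in> E)"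
    using finite_representatives[OF Q(1)] by blast
  obtain Es where Es: "approximation E Es" using ceer_E ce_rel_approximation unfolding ceer_def by blast
  \<comment> \<open>In a witness (stage, m), an even \<open>m\<close> stands for itself and an odd
    \<open>m\<close> for the entry of \<open>qs\<close> at \<open>m div 2\<close>; this is already
    the coding of the uniform join.\<close>
  define P where "P x w \<longleftrightarrow> (if even (snd w) then Es (fst w) (f x) (snd w) else
    snd w div 2 < length qs \<and> Es (fst w) (f x) (hd (drop (snd w div 2) qs)))" for x and w :: "nat \<times> nat"
  have "decidable (\<lambda>p. P (fst p) (snd p))" unfolding P_def
    by (intro rec_intros decidable_comp3[OF approximation.decidable[OF Es]] rec_fun_comp[OF f(1)])
  moreover have "\<exists>w. P x w" for x
  proof -
    have "(\<exists>u. (f x, 2 * u) \<in> E) \<or> (\<exists>i<length qs. (f x, qs ! i) \<in> E)"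
      using Q(2)[of x] qs(3) E_trans by meson
    thus ?thesis
    proof
      assume "\<exists>u. (f x, 2 * u) \<in> E"
      then obtain u s where "Es s (f x) (2 * u)" using approximation.iff[OF Es] by blast
      thus ?thesis by (intro exI[of _ "(s, 2 * u)"]) (simp add: P_def)
    next
      assume "\<exists>i<length qs. (f x, qs ! i) \<in> E"
      then obtain i s where "i < length qs" "Es s (f x) (qs ! i)" using approximation.iff[OF Es] by blast
      thus ?thesis by (intro exI[of _ "(s, Suc (2 * i))"]) (simp add: P_def hd_drop_conv_nth)
    qed
  qed
  ultimately obtain h where h: "rec_fun h" "\<And>x. P x (h x)" using rec_search[of P] by blast
  define c where "c m = (if even m then m else qs ! (m div 2))" for m
  have fc: "(f x, c (snd (h x))) \<in> E" for x
    using h(2)[of x] approximation.iff[OF Es] by (auto simp: P_def c_def hd_drop_conv_nth split: if_splits)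
  have valid: "odd (snd (h x)) \<Longrightarrow> snd (h x) div 2 < length qs" for x
    using h(2)[of x] by (simp add: P_def)
  \<comment> \<open>All positions lie below the modulus \<open>Suc (length qs)\<close>, so they are
    distinct modulo it; the successor keeps it positive when \<open>qs\<close> is empty.\<close>
  have "X \<le>\<^sub>c A \<oplus>\<^sub>c Id_mod (Suc (length qs))"
  proof (rule reducibleI[where f = "\<lambda>x. snd (h x)"])
    show "rec_fun (\<lambda>x. snd (h x))" by (intro rec_intros h(1))
    fix x y
    let ?m = "snd (h x)" and ?n = "snd (h y)"
    have "(x, y) \<in> X \<longleftrightarrow> (c ?m, c ?n) \<in> E"
      unfolding f(2) using fc[of x] fc[of y] E_sym E_trans by meson
    also have "\<dots> \<longleftrightarrow> (?m, ?n) \<in> A \<oplus>\<^sub>c Id_mod (Suc (length qs))"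
    proof -
      consider "even ?m" "even ?n" | "even ?m" "odd ?n" | "odd ?m" "even ?n" | "odd ?m" "odd ?n" by blast
      thus ?thesis
      proof cases
        case 1
        thus ?thesis using double[of "?m div 2" "?n div 2"] by (simp add: c_def uniform_join_iff)
      next
        case 2
        thus ?thesis using qs(2)[OF valid[OF 2(2)], of "?m div 2"] E_sym
          by (auto simp: c_def uniform_join_iff)
      next
        case 3
        thus ?thesis using qs(2)[OF valid[OF 3(1)], of "?n div 2"]
          by (auto simp: c_def uniform_join_iff)
      next
        case 4
        thus ?thesis using qs(1)[OF valid[OF 4(1)] valid[OF 4(2)]] E_refl valid[OF 4(1)] valid[OF 4(2)]
          by (auto simp: c_def uniform_join_iff Id_mod_iff)
      qed
    qed
    finally show "(x, y) \<in> X \<longleftrightarrow> (?m, ?n) \<in> A \<oplus>\<^sub>c Id_mod (Suc (length qs))" .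
  qed
  thus ?thesis by (intro disjI2 exI[of _ "Suc (length qs)"]) simp
qed simp

text \<open>A reduction whose range meets every class can be inverted by searching, for given
  \<open>y\<close>, a preimage of its class.\<close>

lemma reducible_dichotomy:
  assumes "X \<le>\<^sub>c E" shows "E \<le>\<^sub>c X \<or> (\<exists>k\<ge>1. X \<le>\<^sub>c A \<oplus>\<^sub>c Id_mod k)"
proof -
  obtain f where f: "reduces_via f X E" using assms unfolding reducible_def by blast
  from reduction_dichotomy[OF f] show ?thesis
  proof
    assume meets: "\<forall>y. \<exists>x. (f x, y) \<in> E"
    have rf: "rec_fun f" and red: "\<And>x y. (x, y) \<in> X \<longleftrightarrow> (f x, f y) \<in> E"
      using f by (auto simp: reduces_via_def rec_fun_nat)
    obtain Es where Es: "approximation E Es" using ceer_E ce_rel_approximation unfolding ceer_def by blast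
    define P where "P y w \<longleftrightarrow> Es (fst w) (f (snd w)) y" for y and w :: "nat \<times> nat"
    have "decidable (\<lambda>p. P (fst p) (snd p))" unfolding P_def
      by (intro rec_intros decidable_comp3[OF approximation.decidable[OF Es]] rec_fun_comp[OF rf])
    moreover have "\<exists>w. P y w" for y
      using meets approximation.iff[OF Es] by (fastforce simp: P_def)
    ultimately obtain h where h: "rec_fun h" "\<And>x. P x (h x)" using rec_search[of P] by blast
    have fh: "(f (snd (h y)), y) \<in> E" for y
      using h(2)[of y] approximation.iff[OF Es] by (auto simp: P_def)
    have "E \<le>\<^sub>c X"
    proof (rule reducibleI[where f = "\<lambda>y. snd (h y)"])
      show "rec_fun (\<lambda>y. snd (h y))" by (intro rec_intros h(1))
      show "(x, y) \<in> E \<longleftrightarrow> (snd (h x), snd (h y)) \<in> X" for x y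
        unfolding red using fh[of x] fh[of y] E_sym E_trans by meson
    qed
    thus ?thesis ..
  qed simp
qed

section \<open>Inseparability, join-irreducibility and self-fullness\<close>

lemma not_finitely_many_new:
  assumes "finite Q" "\<And>x. (\<exists>u. (x, 2 * u) \<in> E) \<or> (\<exists>q\<in>Q. (x, q) \<in> E)" shows False
proof -
  have "\<exists>q\<in>Q. (g i, q) \<in> E" for i using assms(2)[of "g i"] g_new by blast
  then obtain c where c: "\<And>i. c i \<in> Q" "\<And>i. (g i, c i) \<in> E" by metis
  have "inj c"
  proof (rule injI)
    fix i j assume "c i = c j"
    hence "(g i, g j) \<in> E" using c(2)[of i] c(2)[of j] E_sym E_trans by metis
    thus "i = j" by (simp add: g_inj)
  qed
  moreover have "range c \<subseteq> Q" using c(1) by blast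
  ultimately show False using assms(1) finite_subset infinite_UNIV_nat finite_imageD by blast
qed

text \<open>A separating set and its complement are ranges of computable functions missing a class,
  so together they would leave only finitely many classes outside the even numbers.\<close>

lemma not_separable:
  assumes C: "computable_set C" and a: "\<And>x. (x, a) \<in> E \<Longrightarrow> x \<in> C" and b: "\<And>x. (x, b) \<in> E \<Longrightarrow> x \<notin> C"
  shows False
proof -
  have dC: "decidable (\<lambda>x. x \<in> C)" using C by (simp add: computable_set_def decidable_def rec_fun_nat)
  have aC: "a \<in> C" and bC: "b \<notin> C" using a b E_refl by blast+
  define f1 where "f1 x = (if x \<in> C then x else a)" for x
  define f2 where "f2 x = (if x \<in> C then b else x)" for x
  have "rec_fun f1" "rec_fun f2" unfolding f1_def f2_def by (intro rec_intros dC)+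
  hence comp: "computable f1" "computable f2" by (simp_all add: rec_fun_nat)
  have "(f1 x, b) \<notin> E" for x using b[of "f1 x"] aC by (auto simp: f1_def)
  then obtain Q1 where Q1: "finite Q1" "\<And>x. (\<exists>u. (f1 x, 2 * u) \<in> E) \<or> (\<exists>q\<in>Q1. (f1 x, q) \<in> E)"
    using range[OF comp(1)] by blast
  have "(f2 x, a) \<notin> E" for x using a[of "f2 x"] bC by (auto simp: f2_def)
  then obtain Q2 where Q2: "finite Q2" "\<And>x. (\<exists>u. (f2 x, 2 * u) \<in> E) \<or> (\<exists>q\<in>Q2. (f2 x, q) \<in> E)"
    using range[OF comp(2)] by blast
  \<comment> \<open>Every \<open>x\<close> is fixed by \<open>f1\<close> or by \<open>f2\<close>, so
    one of the two bounds applies to \<open>x\<close> itself.\<close>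
  have "(\<exists>u. (x, 2 * u) \<in> E) \<or> (\<exists>q\<in>Q1 \<union> Q2. (x, q) \<in> E)" for x
    using Q1(2)[of x] Q2(2)[of x] by (cases "x \<in> C") (auto simp: f1_def f2_def)
  with Q1(1) Q2(1) show False using not_finitely_many_new[of "Q1 \<union> Q2"] by blast
qed

lemma classes_inseparable:
  assumes "S \<in> UNIV // E" "T \<in> UNIV // E" "S \<noteq> T" shows "computably_inseparable S T"
proof -
  obtain a b where ab: "S = E `` {a}" "T = E `` {b}" using assms(1,2) by (auto elim!: quotientE)
  have "S \<inter> T = {}"
    using quotient_disj[of UNIV E S T] ceer_E assms by (auto simp: ceer_def)
  moreover have False if "computable_set C" "S \<subseteq> C" "T \<inter> C = {}" for C
    using that(2,3) E_sym by (intro not_separable[OF that(1), of a b]) (auto simp: ab)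
  moreover have False if "computable_set C" "T \<subseteq> C" "S \<inter> C = {}" for C
    using that(2,3) E_sym by (intro not_separable[OF that(1), of b a]) (auto simp: ab)
  ultimately show ?thesis unfolding computably_inseparable_def by blast
qed

lemma class_not_computable:
  assumes "S \<in> UNIV // E" shows "\<not> computable_set S"
proof
  assume C: "computable_set S"
  obtain a where a: "S = E `` {a}" using assms by (auto elim!: quotientE)
  have "\<exists>i. (a, g i) \<notin> E" using g_inj[of 0 1] E_sym E_trans by (metis zero_neq_one)
  then obtain i where i: "(a, g i) \<notin> E" ..
  define T where "T = E `` {g i}"
  have T: "T \<in> UNIV // E" by (auto simp: T_def intro: quotientI)
  have "S \<noteq> T" using i E_refl[of "g i"] by (auto simp: a T_def)
  hence "computably_inseparable S T" by (rule classes_inseparable[OF assms T])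
  thus False using C unfolding computably_inseparable_def by blast
qed

text \<open>The set of \<open>x\<close> with \<open>f x\<close> even is computable and a union of
  classes. By inseparability it is empty or everything, so \<open>f\<close> lands on one side of the
  join.\<close>

lemma join_irreducible:
  assumes "E \<le>\<^sub>c R1 \<oplus>\<^sub>c R2" shows "E \<le>\<^sub>c R1 \<or> E \<le>\<^sub>c R2"
proof -
  obtain f where f: "rec_fun f" "\<And>x y. (x, y) \<in> E \<longleftrightarrow> (f x, f y) \<in> R1 \<oplus>\<^sub>c R2"
    using assms unfolding reducible_def reduces_via_def rec_fun_nat by blast
  have half: "rec_fun (\<lambda>x. f x div 2)" by (intro rec_intros f(1))
  have parity: "(x, y) \<in> E \<Longrightarrow> even (f x) \<longleftrightarrow> even (f y)" for x y
    unfolding f(2) uniform_join_iff by (auto split: if_splits)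
  have "decidable (\<lambda>x. even (f x))" by (intro rec_intros f(1))
  hence C: "computable_set {x. even (f x)}" by (simp add: computable_set_def decidable_def rec_fun_nat)
  have "(\<forall>x. even (f x)) \<or> (\<forall>x. odd (f x))"
    using not_separable[OF C] parity by blast
  thus ?thesis
  proof
    assume "\<forall>x. even (f x)"
    hence "E \<le>\<^sub>c R1" by (intro reducibleI[OF half]) (simp add: f(2) uniform_join_iff)
    thus ?thesis ..
  next
    assume "\<forall>x. odd (f x)"
    hence "E \<le>\<^sub>c R2" by (intro reducibleI[OF half]) (simp add: f(2) uniform_join_iff)
    thus ?thesis ..
  qed
qed

lemma not_reducible_Id_mod:
  assumes "k \<ge> 1" shows "\<not> E \<le>\<^sub>c Id_mod k"
proof
  assume "E \<le>\<^sub>c Id_mod k"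
  then obtain f where f: "\<And>x y. (x, y) \<in> E \<longleftrightarrow> f x mod k = f y mod k"
    by (elim reducibleE) (auto simp: Id_mod_iff)
  have "inj (\<lambda>i. f (g i) mod k)" by (rule injI) (simp add: f[symmetric] g_inj)
  moreover have "range (\<lambda>i. f (g i) mod k) \<subseteq> {..<k}" using assms by auto
  ultimately show False using finite_subset infinite_UNIV_nat finite_imageD finite_lessThan by metis
qed

lemma not_reducible_join_Id:
  assumes "\<not> E \<le>\<^sub>c A" "k \<ge> 1" shows "\<not> E \<le>\<^sub>c A \<oplus>\<^sub>c Id_mod k"
  using join_irreducible not_reducible_Id_mod assms by blast

text \<open>A self-reduction missing a class would place \<open>E\<close> below some
  \<open>A \<oplus>\<^sub>c Id_mod k\<close>, which join-irreducibility and the infinitude of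
  classes forbid.\<close>

lemma self_full_E:
  assumes "\<not> E \<le>\<^sub>c A" shows "self_full E"
  unfolding self_full_def using reduction_dichotomy[of _ E] not_reducible_join_Id[OF assms] ceer_E by blast

end

text \<open>A universal \<open>E\<close> absorbs \<open>E \<oplus>\<^sub>c Id_mod 1\<close>.
  Restricted to the copy of \<open>E\<close>, that reduction maps \<open>E\<close> to itself and
  misses the class of \<open>f 1\<close>, the image of the extra class.\<close>

lemma self_full_not_universal:
  assumes "self_full E" shows "\<not> universal_ceer E"
proof
  assume "universal_ceer E"
  hence "E \<oplus>\<^sub>c Id_mod 1 \<le>\<^sub>c E"
    unfolding universal_ceer_def by (simp add: ceer_uniform_join ceer_Id_mod)
  then obtain f where f: "rec_fun f" "\<And>x y. (x, y) \<in> E \<oplus>\<^sub>c Id_mod 1 \<longleftrightarrow> (f x, f y) \<in> E"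
    unfolding reducible_def reduces_via_def rec_fun_nat by blast
  have "rec_fun (\<lambda>x. f (2 * x))" by (intro rec_fun_comp[OF f(1)] rec_intros)
  moreover have "(x, y) \<in> E \<longleftrightarrow> (f (2 * x), f (2 * y)) \<in> E" for x y
    unfolding f(2)[symmetric] by (simp add: uniform_join_iff)
  ultimately have "reduces_via (\<lambda>x. f (2 * x)) E E" by (simp add: reduces_via_def rec_fun_nat)
  then obtain k where "(f (2 * k), f 1) \<in> E" using assms unfolding self_full_def by blast
  thus False unfolding f(2)[symmetric] by (simp add: uniform_join_iff)
qed

section \<open>Existence of covers and the sequence of incomparable ones\<close>

lemma minimal_cover_exists:
  assumes "ceer A" "ceer R" "\<not> universal_ceer R"
  shows "\<exists>E. (\<exists>g. minimal_cover A E g) \<and> \<not> E \<le>\<^sub>c R"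
proof -
  obtain V where V: "ceer V" "\<not> V \<le>\<^sub>c R" using assms(2,3) unfolding universal_ceer_def by blast
  from strong_minimal_cover_construction[OF assms(1,2) V] show ?thesis
    unfolding minimal_cover_def by metis
qed

text \<open>A cover of \<open>V1 \<oplus>\<^sub>c V2\<close> lies above both \<open>V1\<close> and
  \<open>V2\<close>. If the join were universal, join-irreducibility would put the cover, and thus
  one of the \<open>V\<close>s, below the corresponding component.\<close>

lemma not_universal_uniform_join:
  assumes "ceer R1" "\<not> universal_ceer R1" "ceer R2" "\<not> universal_ceer R2"
  shows "\<not> universal_ceer (R1 \<oplus>\<^sub>c R2)"
proof
  assume univ: "universal_ceer (R1 \<oplus>\<^sub>c R2)"
  obtain V1 where V1: "ceer V1" "\<not> V1 \<le>\<^sub>c R1" using assms(1,2) unfolding universal_ceer_def by blast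
  obtain V2 where V2: "ceer V2" "\<not> V2 \<le>\<^sub>c R2" using assms(3,4) unfolding universal_ceer_def by blast
  obtain E g where E: "minimal_cover (V1 \<oplus>\<^sub>c V2) E g"
    using minimal_cover_exists[OF ceer_uniform_join[OF V1(1) V2(1)] assms(1,2)] by blast
  interpret minimal_cover "V1 \<oplus>\<^sub>c V2" E g by (rule E)
  have "E \<le>\<^sub>c R1 \<oplus>\<^sub>c R2" using univ ceer_E unfolding universal_ceer_def by blast
  hence "E \<le>\<^sub>c R1 \<or> E \<le>\<^sub>c R2" by (rule join_irreducible)
  moreover have "V1 \<le>\<^sub>c E" "V2 \<le>\<^sub>c E"
    using reducible_trans[OF reducible_join_left A_reducible]
      reducible_trans[OF reducible_join_right A_reducible] by blast+
  ultimately show False using V1(2) V2(2) reducible_trans by blast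
qed

theorem theorem4p10:
  fixes A :: "nat rel"
  assumes "ceer A" and "\<not> universal_ceer A"
  shows "\<exists>E :: nat \<Rightarrow> nat rel.
    (\<forall>l. ceer (E l) \<and> self_full (E l)) \<and>
    (\<forall>l m. l \<noteq> m \<longrightarrow> incomparable (E l) (E m)) \<and>
    (\<forall>n l. n \<ge> 1 \<longrightarrow> A \<oplus>\<^sub>c Id_mod n \<le>\<^sub>c E l) \<and>
    (\<forall>l X. ceer X \<and> X <\<^sub>c E l \<longrightarrow> (\<exists>k\<ge>1. X \<le>\<^sub>c A \<oplus>\<^sub>c Id_mod k)) \<and>
    (\<forall>l. \<forall>S \<in> UNIV // E l. \<forall>T \<in> UNIV // E l. S \<noteq> T \<longrightarrow> computably_inseparable S T) \<and>
    (\<forall>l. \<forall>S \<in> UNIV // E l. \<not> computable_set S)"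
proof -
  define F where "F R = (SOME E. (\<exists>g. minimal_cover A E g) \<and> \<not> E \<le>\<^sub>c R)" for R
  have F: "(\<exists>g. minimal_cover A (F R) g) \<and> \<not> F R \<le>\<^sub>c R" if "ceer R" "\<not> universal_ceer R" for R
    unfolding F_def by (rule someI_ex[OF minimal_cover_exists[OF assms(1) that]])
  \<comment> \<open>\<open>B l\<close> joins \<open>A\<close> with all covers chosen before
    \<open>l\<close>; the next cover is chosen so as not to reduce to it.\<close>
  define B where "B = rec_nat A (\<lambda>_ R. R \<oplus>\<^sub>c F R)"
  have B_Suc: "B (Suc l) = B l \<oplus>\<^sub>c F (B l)" for l by (simp add: B_def)
  have B: "ceer (B l) \<and> \<not> universal_ceer (B l) \<and> A \<le>\<^sub>c B l" for l
  proof (induction l)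
    case 0
    have "A \<le>\<^sub>c A" by (rule reducibleI[OF rec_fun_id]) simp
    thus ?case using assms by (simp add: B_def)
  next
    case (Suc l)
    from F[of "B l"] Suc obtain g where "minimal_cover A (F (B l)) g" "\<not> F (B l) \<le>\<^sub>c B l" by blast
    then interpret minimal_cover A "F (B l)" g by simp
    \<comment> \<open>As \<open>A\<close> lies below \<open>B l\<close>, the new cover is not below
      \<open>A\<close>. So it is self-full, hence not universal, and the join
      \<open>B (Suc l)\<close> remains non-universal.\<close>
    have "\<not> F (B l) \<le>\<^sub>c A" using \<open>\<not> F (B l) \<le>\<^sub>c B l\<close> Suc reducible_trans by blast
    hence "\<not> universal_ceer (F (B l))" using self_full_E self_full_not_universal by blast
    thus ?case unfolding B_Suc using Suc ceer_E
      by (blast intro: ceer_uniform_join reducible_trans[OF _ reducible_join_left]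
          dest: not_universal_uniform_join[rotated -1])
  qed
  define E where "E l = F (B l)" for l
  have "\<exists>g. minimal_cover A (E l) g" for l using F B by (simp add: E_def)
  then obtain g where g: "\<And>l. minimal_cover A (E l) (g l)" by metis
  have not_B: "\<not> E l \<le>\<^sub>c B l" for l using F B by (simp add: E_def)
  have not_A: "\<not> E l \<le>\<^sub>c A" for l using not_B B reducible_trans by blast
  have B_mono: "B l \<le>\<^sub>c B m" if "l \<le> m" for l m
    using that
  proof (induction m rule: dec_induct)
    case base
    show ?case by (rule reducibleI[OF rec_fun_id]) simp
  next
    case (step m)
    thus ?case unfolding B_Suc using reducible_trans reducible_join_left by blast
  qed
  have incomp: "incomparable (E l) (E m)" if "l < m" for l m
  proof -
    have "E l \<le>\<^sub>c B (Suc l)" unfolding B_Suc E_def by (rule reducible_join_right)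
    hence "E l \<le>\<^sub>c B m" using B_mono[of "Suc l" m] that reducible_trans by auto
    hence ml: "\<not> E m \<le>\<^sub>c E l" using not_B reducible_trans by blast
    \<comment> \<open>The dichotomy for \<open>E m\<close> would give
      \<open>E m \<le>\<^sub>c E l\<close>, excluded by \<open>ml\<close>, or put \<open>E l\<close>
      below some \<open>A \<oplus>\<^sub>c Id_mod k\<close>.\<close>
    moreover have "\<not> E l \<le>\<^sub>c E m"
      using minimal_cover.reducible_dichotomy[OF g, of "E l" m] ml
        minimal_cover.not_reducible_join_Id[OF g not_A] by blast
    ultimately show ?thesis by (simp add: incomparable_def)
  qed
  have "incomparable (E l) (E m)" if "l \<noteq> m" for l m
    using incomp[of l m] incomp[of m l] that by (auto simp: incomparable_def neq_iff)
  moreover have "\<exists>k\<ge>1. X \<le>\<^sub>c A \<oplus>\<^sub>c Id_mod k" if "ceer X \<and> X <\<^sub>c E l" for X l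
    using that minimal_cover.reducible_dichotomy[OF g] unfolding strictly_reducible_def by blast
  ultimately show ?thesis
  proof (intro exI[of _ E] conjI allI impI ballI)
    fix l n S T
    show "ceer (E l)" by (rule minimal_cover.ceer_E[OF g])
    show "self_full (E l)" by (rule minimal_cover.self_full_E[OF g not_A])
    show "A \<oplus>\<^sub>c Id_mod n \<le>\<^sub>c E l" if "n \<ge> 1"
      using that by (rule minimal_cover.join_Id_reducible[OF g])
    show "\<not> computable_set S" if "S \<in> UNIV // E l"
      using that by (rule minimal_cover.class_not_computable[OF g])
    show "computably_inseparable S T" if "S \<in> UNIV // E l" "T \<in> UNIV // E l" "S \<noteq> T"
      using that by (rule minimal_cover.classes_inseparable[OF g])
  qed simp_all
qed

end
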